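(* Let $\alpha,\beta$ be integers different from $1$, and let $m=v_2(\alpha-1)$, $n=v_2(\beta-1)$, $\ell=v_2(\alpha-\beta)$. Suppose $n>1$ and $m>n=\ell$. Then $|G_2|=2^{m+4n}$, the nilpotency class of $G_2$ is $3$, $o(a)=2^{m+n}$, $o(b)=2^{2n}$ and $o(c)=2^{n+1}$.
   Context: $G(\alpha,\beta)=\langle A,B\mid A^{[A,B]}=A^{\alpha},\ B^{[B,A]}=B^{\beta}\rangle$ with $[x,y]=x^{-1}y^{-1}xy$, $y^x=x^{-1}yx$, and $C=[A,B]$. The group $G(\alpha,\beta)$ is finite and nilpotent, hence the direct product of its Sylow subgroups; $G_2$ denotes its Sylow $2$-subgroup and $a,b,c$ denote the images of $A,B,C$ under the canonical projection $G(\alpha,\beta)\to G_2$. $v_2$ is the $2$-adic valuation and $o(x)$ the order of $x$. *)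

theory Defs
  imports "HOL-Algebra.Algebra" "HOL-Computational_Algebra.Primes"
begin

definition gcomm :: "('g, 'm) monoid_scheme \<Rightarrow> 'g \<Rightarrow> 'g \<Rightarrow> 'g" where
  "gcomm G x y = inv\<^bsub>G\<^esub> x \<otimes>\<^bsub>G\<^esub> inv\<^bsub>G\<^esub> y \<otimes>\<^bsub>G\<^esub> x \<otimes>\<^bsub>G\<^esub> y"

definition gconj :: "('g, 'm) monoid_scheme \<Rightarrow> 'g \<Rightarrow> 'g \<Rightarrow> 'g" where
  "gconj G y x = inv\<^bsub>G\<^esub> x \<otimes>\<^bsub>G\<^esub> y \<otimes>\<^bsub>G\<^esub> x"

definition rels :: "('g, 'm) monoid_scheme \<Rightarrow> int \<Rightarrow> int \<Rightarrow> 'g \<Rightarrow> 'g \<Rightarrow> bool" where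
  "rels G \<alpha> \<beta> x y \<longleftrightarrow>
     gconj G x (gcomm G x y) = x [^]\<^bsub>G\<^esub> \<alpha> \<and>
     gconj G y (gcomm G y x) = y [^]\<^bsub>G\<^esub> \<beta>"

(* (G, A, B) is a presentation of <A,B | A^[A,B]=A^alpha, B^[B,A]=B^beta>:
   G is a group generated by A, B satisfying the relations, and for every group H
   and elements x, y of H satisfying the relations there is a homomorphism G -> H
   with A |-> x, B |-> y.  Test groups are taken on carrier type nat, which
   suffices since the presented group is countable. *)
definition presented_by :: "('g, 'm) monoid_scheme \<Rightarrow> 'g \<Rightarrow> 'g \<Rightarrow> int \<Rightarrow> int \<Rightarrow> bool" where
  "presented_by G A B \<alpha> \<beta> \<longleftrightarrow>
     group G \<and> A \<in> carrier G \<and> B \<in> carrier G \<and>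
     generate G {A, B} = carrier G \<and> rels G \<alpha> \<beta> A B \<and>
     (\<forall>(H :: nat monoid) x y. group H \<and> x \<in> carrier H \<and> y \<in> carrier H \<and> rels H \<alpha> \<beta> x y
        \<longrightarrow> (\<exists>h \<in> hom G H. h A = x \<and> h B = y))"

definition comm_subgroup :: "('g, 'm) monoid_scheme \<Rightarrow> 'g set \<Rightarrow> 'g set \<Rightarrow> 'g set" where
  "comm_subgroup G H K = generate G {gcomm G h k | h k. h \<in> H \<and> k \<in> K}"

fun lcs :: "('g, 'm) monoid_scheme \<Rightarrow> nat \<Rightarrow> 'g set" where
  "lcs G 0 = carrier G"
| "lcs G (Suc 0) = carrier G"
| "lcs G (Suc (Suc i)) = comm_subgroup G (lcs G (Suc i)) (carrier G)"

definition nilpotency_class_is :: "('g, 'm) monoid_scheme \<Rightarrow> nat \<Rightarrow> bool" where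
  "nilpotency_class_is G c \<longleftrightarrow>
     lcs G (Suc c) = {\<one>\<^bsub>G\<^esub>} \<and> (\<forall>d < c. lcs G (Suc d) \<noteq> {\<one>\<^bsub>G\<^esub>})"

definition sylow2 :: "('g, 'm) monoid_scheme \<Rightarrow> 'g set \<Rightarrow> bool" where
  "sylow2 G P \<longleftrightarrow> subgroup P G \<and> card P = 2 ^ multiplicity (2::nat) (order G)"

end

theory Submission
  imports Defs "HOL-Library.Countable"
begin

text \<open>
  Write \<open>C = [A, B]\<close>. Evaluating \<open>[A, B\<^sup>\<beta>]\<close> in two ways gives \<open>B\<^sup>x C\<^sup>\<beta> = C\<^sup>\<alpha> A\<^sup>y\<close> for explicit \<open>x\<close>
  and \<open>y\<close>. Hence \<open>B\<^sup>x\<close> acts on the powers of \<open>A\<close> like \<open>C^(\<alpha> - \<beta>)\<close>, and symmetrically for \<open>A\<^sup>y\<close>. This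
  forces \<open>A\<close>, \<open>B\<close> and \<open>C\<close> to have finite order, and since every element has the form
  \<open>C\<^sup>j A\<^sup>i B\<^sup>k\<close>, the group is finite.

  Comparing the action of \<open>B\<^sup>x\<close> on \<open>A\<close> with the general formula for \<open>[A, B\<^sup>x]\<close>, together with the
  mirror image of this argument, gives \<open>A\<^sup>s = C\<^sup>t\<close> and \<open>B^s' = C^t'\<close>. The two-adic valuations of the
  exponents involved imply that, up to odd factors, the orders of \<open>A\<close> and \<open>C\<close> divide \<open>2^(m + n)\<close> and
  \<open>2^(n + 1)\<close> and that \<open>B^(2^(2 n - 1))\<close> lies in the subgroup generated by \<open>A\<close> and \<open>C\<close>. So
  \<open>2^(m + 4 n)\<close> bounds the two-part of the group order, without any appeal to nilpotency.

  Conversely an explicit group of order \<open>2^(m + 4 n)\<close> and class three satisfies the relations. The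
  kernel of the map onto it has odd order, so this map restricts to an isomorphism on every Sylow
  2-subgroup.
\<close>

section \<open>Two-adic valuations of geometric sums\<close>

text \<open>The exponents x and y contain powers such as \<alpha>^\<alpha>, so the explicit relation
  is available only for positive \<alpha> and \<beta>. Finite orders are therefore established
  first, from a qualitative form of the relation that holds for all signs and records only in which
  hulls the factors lie; afterwards \<alpha> and \<beta> can be shifted by multiples of the orders
  of A and B until they are positive. For the upper bound no exact order is computed in G: each
  bound is a power that vanishes, or lands in a smaller subgroup, with an exponent of known 2-adic
  valuation, and odd factors are multiplied in freely. The exponent m + 4 n is the sum of three such
  valuations: n + 1 for C, m + n for A, and 2 n - 1 for B modulo the products of powers of C and
  A.\<close>

definition val2 :: "nat \<Rightarrow> int \<Rightarrow> bool" where
  "val2 p k \<longleftrightarrow> (\<exists>u. odd u \<and> k = 2 ^ p * u)"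

lemma val2_multiplicity:
  assumes "k \<noteq> 0"
  shows "val2 (multiplicity 2 k) k"
proof -
  obtain u where u: "k = 2 ^ multiplicity 2 k * u" "\<not> 2 dvd u"
    using multiplicity_decompose'[of k "2::int"] assms by auto
  then show ?thesis unfolding val2_def by blast
qed

lemma val2_dvd: "val2 p k \<Longrightarrow> q \<le> p \<Longrightarrow> 2 ^ q dvd k"
  unfolding val2_def by (auto intro: dvd_mult2 le_imp_power_dvd)

lemma val2_nonzero: "val2 p k \<Longrightarrow> k \<noteq> 0"
  unfolding val2_def by auto

lemma val2_0_iff [simp]: "val2 0 k \<longleftrightarrow> odd k"
  unfolding val2_def by auto

lemma val2_mult: "val2 p k \<Longrightarrow> val2 q l \<Longrightarrow> val2 (p + q) (k * l)"
  unfolding val2_def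
proof (elim exE conjE)
  fix u w assume "odd u" "k = 2 ^ p * u" "odd w" "l = 2 ^ q * w"
  then have "odd (u * w) \<and> k * l = 2 ^ (p + q) * (u * w)" by (simp add: power_add)
  then show "\<exists>u. odd u \<and> k * l = 2 ^ (p + q) * u" by blast
qed

lemma val2_mult_odd: "val2 p k \<Longrightarrow> odd l \<Longrightarrow> val2 p (k * l)"
  using val2_mult[of p k 0 l] by simp

lemma val2_double: "val2 p k \<Longrightarrow> val2 (Suc p) (2 * k)"
  unfolding val2_def by (auto simp: mult.assoc)

lemma val2_add:
  assumes "val2 p k" "2 ^ Suc p dvd l"
  shows "val2 p (k + l)"
proof -
  obtain u where u: "odd u" "k = 2 ^ p * u" using assms(1) unfolding val2_def by blast
  obtain w where w: "l = 2 ^ Suc p * w" using assms(2) by (elim dvdE)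
  have "k + l = 2 ^ p * (u + 2 * w)" using u w by (simp add: algebra_simps)
  then show ?thesis using u(1) unfolding val2_def by (metis even_add dvd_triv_left)
qed

lemma val2_neg [simp]: "val2 p (- k) \<longleftrightarrow> val2 p k"
proof -
  have "val2 p (- k)" if "val2 p k" for k
    using that unfolding val2_def by (metis even_minus mult_minus_right)
  from this[of k] this[of "- k"] show ?thesis by auto
qed

lemma val2_diff: "val2 p k \<Longrightarrow> 2 ^ Suc p dvd l \<Longrightarrow> val2 p (k - l)"
  using val2_add[of p k "- l"] by simp

lemma val2_pow_odd: "odd q \<Longrightarrow> val2 p k \<Longrightarrow> val2 p (k * q ^ i)"
  by (rule val2_mult_odd) auto

lemma val2_power_dvd: "val2 p k \<Longrightarrow> 2 ^ q dvd k \<longleftrightarrow> q \<le> p"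
proof
  assume v: "val2 p k" and d: "2 ^ q dvd k"
  show "q \<le> p"
  proof (rule ccontr)
    assume "\<not> q \<le> p"
    then have "2 ^ Suc p dvd k" using d by (meson dvd_trans le_imp_power_dvd not_less_eq_eq)
    moreover obtain u where u: "odd u" "k = 2 ^ p * u" using v unfolding val2_def by blast
    ultimately show False by simp
  qed
qed (rule val2_dvd)

section \<open>Geometric sums modulo powers of two\<close>

definition gsum :: "int \<Rightarrow> nat \<Rightarrow> int" where
  "gsum q k = (\<Sum>i<k. q ^ i)"

lemma gsum_0 [simp]: "gsum q 0 = 0" by (simp add: gsum_def)

lemma gsum_Suc: "gsum q (Suc k) = gsum q k + q ^ k" by (simp add: gsum_def)

lemma gsum_pow_minus_one: "(q - 1) * gsum q k = q ^ k - 1"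
  by (induction k) (auto simp: gsum_Suc algebra_simps)

lemma gsum_add: "gsum q (k + l) = gsum q k + q ^ k * gsum q l"
  by (induction l) (auto simp: gsum_Suc algebra_simps power_add)

lemma gsum_Suc': "gsum q (Suc k) = q * gsum q k + 1"
  using gsum_add[of q 1 k] by (simp add: gsum_Suc)

lemma gsum_cong_linear: "p dvd q - 1 \<Longrightarrow> p dvd gsum q k - int k"
proof (induction k)
  case (Suc k)
  have "p dvd q ^ k - 1" using Suc.prems gsum_pow_minus_one[of q k] by (metis dvd_mult2)
  then have "p dvd (gsum q k - int k) + (q ^ k - 1)" using Suc by (intro dvd_add) auto
  then show ?case by (simp add: gsum_Suc algebra_simps)
qed auto

lemma odd_gsum: "odd q \<Longrightarrow> odd k \<Longrightarrow> odd (gsum q k)"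
  using gsum_cong_linear[of 2 q k] by simp

lemma gsum_double: "gsum q (2 * k) = gsum q k * (1 + q ^ k)"
  using gsum_add[of q k k] unfolding mult_2 by (simp add: distrib_left mult.commute)

lemma dvd_gsum:
  assumes "odd q"
  shows "2 ^ p dvd int k \<Longrightarrow> 2 ^ p dvd gsum q k"
proof (induction p arbitrary: k)
  case (Suc p)
  then obtain l where l: "int k = 2 * (2 ^ p * l)" by (auto elim!: dvdE simp: mult.assoc)
  then obtain k' where k': "k = 2 * k'" by (metis dvd_triv_left even_of_nat_iff evenE)
  then have "2 ^ p dvd gsum q k'" using Suc.IH[of k'] l by simp
  moreover have "even (1 + q ^ k')" using assms by simp
  ultimately have "2 ^ p * 2 dvd gsum q k' * (1 + q ^ k')" by (rule mult_dvd_mono)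
  then show ?case unfolding k' gsum_double by (simp add: mult.commute)
qed simp

text \<open>For q = 1 mod 4 each doubling of the index multiplies the sum by 1 + q^k, which is 2 mod
  4 and so contributes exactly one factor 2.\<close>

lemma val2_gsum:
  assumes "4 dvd q - 1"
  shows "val2 p (int k) \<Longrightarrow> val2 p (gsum q k)"
proof (induction p arbitrary: k)
  case 0
  then show ?case using odd_gsum[of q k] assms by simp presburger
next
  case (Suc p)
  then obtain u where u: "odd u" "int k = 2 * (2 ^ p * u)" unfolding val2_def
      by (auto simp: mult.assoc)
  then obtain k' where k': "k = 2 * k'" by (metis dvd_triv_left even_of_nat_iff evenE)
  then have "val2 p (gsum q k')" using Suc.IH[of k'] u unfolding val2_def by auto
  moreover have "val2 1 (1 + q ^ k')"
  proof -
    have "4 dvd q ^ k' - 1" using assms gsum_pow_minus_one[of q k'] by (metis dvd_mult2)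
    then have "val2 1 (2 + (q ^ k' - 1))" by (intro val2_add) (auto simp: val2_def)
    then show ?thesis by (simp add: algebra_simps)
  qed
  ultimately show ?case unfolding k' gsum_double using val2_mult by fastforce
qed

lemma val2_pow_minus_one:
  assumes "val2 n (q - 1)" "2 \<le> n" "val2 p (int k)"
  shows "val2 (n + p) (q ^ k - 1)"
proof -
  have "4 dvd q - 1" using val2_dvd[OF assms(1,2)] by simp
  from val2_mult[OF assms(1) val2_gsum[OF this assms(3)]] show ?thesis
    by (simp add: gsum_pow_minus_one)
qed

text \<open>The error satisfies gsum q (2 k) - 2 k = 2 (gsum q k - k) + gsum q k (q^k - 1), so it
  gains a factor 2 with each doubling. The bound has \<open>n\<close> where the hypothesis has
  \<open>Suc n\<close> because the leading error is (q - 1) k (k - 1) / 2.\<close>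

lemma gsum_cong_fine:
  assumes "2 ^ Suc n dvd q - 1"
  shows "2 ^ p dvd int k \<Longrightarrow> 2 ^ (p + n) dvd gsum q k - int k"
proof (induction p arbitrary: k)
  case 0
  have "2 ^ n dvd q - 1" using assms by (metis dvd_mult_right power_Suc)
  then show ?case using gsum_cong_linear[of "2 ^ n" q k] by simp
next
  case (Suc p)
  then obtain l where l: "int k = 2 * (2 ^ p * l)" by (auto elim!: dvdE simp: mult.assoc)
  then obtain k' where k': "k = 2 * k'" by (metis dvd_triv_left even_of_nat_iff evenE)
  have d: "2 ^ p dvd int k'" using l k' by simp
  have IH: "2 ^ (p + n) dvd gsum q k' - int k'" using Suc.IH[OF d] .
  have "2 ^ p dvd gsum q k'"
    using dvd_add[OF dvd_trans[OF _ IH] d, of ] by (simp add: power_add)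
  then have "2 ^ Suc n * 2 ^ p dvd (q - 1) * gsum q k'" using assms by (intro mult_dvd_mono)
  then have "2 ^ (Suc p + n) dvd gsum q k' * (q ^ k' - 1)"
    unfolding gsum_pow_minus_one
        by (metis (no_types, lifting) add.commute add_Suc_right dvd_mult power_add)
  moreover have "2 ^ (Suc p + n) dvd 2 * (gsum q k' - int k')"
    using mult_dvd_mono[OF dvd_refl[of 2] IH] by simp
  ultimately have "2 ^ (Suc p + n) dvd 2 * (gsum q k' - int k') + gsum q k' * (q ^ k' - 1)"
      by (rule dvd_add[rotated])
  then show ?case unfolding k' gsum_double by (simp add: algebra_simps)
qed

lemma pow_cong_linear: "(q - 1) ^ 2 dvd q ^ k - 1 - int k * (q - 1)" for q :: int
proof -
  have "q ^ k - 1 - int k * (q - 1) = (q - 1) * (gsum q k - int k)"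
    using gsum_pow_minus_one[of q k] by (simp add: algebra_simps)
  then show ?thesis using gsum_cong_linear[of "q - 1" q k] by (simp add: power2_eq_square)
qed

text \<open>The binomial expansion around q = 1 up to second order, doubled to avoid halving k (k -
  1).\<close>

lemma gsum_cong_quadratic:
  "2 * (q - 1) ^ 2 dvd 2 * gsum q k - 2 * int k - int k * (int k - 1) * (q - 1)"
proof (induction k)
  case (Suc k)
  have "2 * (q - 1) ^ 2 dvd 2 * (q ^ k - 1 - int k * (q - 1))"
    using pow_cong_linear[of q k] by (rule mult_dvd_mono[OF dvd_refl])
  from dvd_add[OF Suc this] show ?case by (simp add: gsum_Suc algebra_simps)
qed auto

lemma val2_halve: "val2 (Suc p) (2 * k) \<Longrightarrow> val2 p k"
  unfolding val2_def by auto

text \<open>This is the origin of the valuation 2 n - 1. With q = k = 1 + e the terms of order below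
  two cancel and the difference is e^2 / 2 up to an odd factor. Base and index coincide because the
  commutator is taken with the \<beta>-th power of B.\<close>

lemma val2_pow_minus_gsum:
  assumes v: "val2 n (q - 1)" and n: "1 \<le> n" and k: "q = int k"
  shows "val2 (2 * n - 1) (q ^ k - gsum q k)"
proof -
  define e where "e = q - 1"
  have q: "q = 1 + e" "int k = 1 + e" using k by (simp_all add: e_def)
  have "2 * e ^ 2 dvd 2 * (q ^ k - 1 - int k * e)"
    using pow_cong_linear[of q k] unfolding e_def by (rule mult_dvd_mono[OF dvd_refl])
  from dvd_diff[OF this gsum_cong_quadratic[of q k, folded e_def]]
  have "2 * e ^ 2 dvd 2 * (q ^ k - gsum q k) - (e ^ 2 - e ^ 2 * e)"
    unfolding q(2) by (simp add: algebra_simps power2_eq_square)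
  then obtain w where "2 * (q ^ k - gsum q k) - (e ^ 2 - e ^ 2 * e) = 2 * e ^ 2 * w" by (elim dvdE)
  then have w: "2 * (q ^ k - gsum q k) = e ^ 2 * (1 - e + 2 * w)" by (simp add: algebra_simps)
  have "even e" using val2_dvd[OF v, of 1] n by (simp add: e_def)
  then have "odd (1 - e + 2 * w)" by simp
  moreover have "val2 (2 * n) (e ^ 2)"
    using val2_mult[OF v v] by (simp add: e_def power2_eq_square mult_2)
  ultimately have "val2 (Suc (2 * n - 1)) (2 * (q ^ k - gsum q k))"
    unfolding w using val2_mult_odd n by simp
  then show ?thesis by (rule val2_halve)
qed

section \<open>Powers of intertwined elements\<close>

context group
begin

lemma inv_intertwine:
  assumes "x \<in> carrier G" "y \<in> carrier G" "w \<in> carrier G" "x \<otimes> y = y \<otimes> w"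
  shows "inv x \<otimes> y = y \<otimes> inv w"
proof -
  have "inv x \<otimes> y = inv x \<otimes> (y \<otimes> w) \<otimes> inv w" using assms(1-3) by (simp add: m_assoc)
  also have "\<dots> = y \<otimes> inv w"
    unfolding assms(4)[symmetric] using assms(1-3) by (simp flip: m_assoc)
  finally show ?thesis .
qed

lemma int_pow_intertwine:
  assumes "x \<in> carrier G" "y \<in> carrier G" "w \<in> carrier G" "x \<otimes> y = y \<otimes> w"
  shows "x [^] (i::int) \<otimes> y = y \<otimes> w [^] i"
proof -
  have nat: "x [^] k \<otimes> y = y \<otimes> w [^] k" for k :: nat
  proof (induction k)
    case (Suc k)
    have "x [^] Suc k \<otimes> y = x [^] k \<otimes> (x \<otimes> y)" using assms(1-3) by (simp add: m_assoc)
    also have "\<dots> = (x [^] k \<otimes> y) \<otimes> w" unfolding assms(4) using assms(1-3) by (simp add: m_assoc)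
    also have "\<dots> = y \<otimes> w [^] Suc k" unfolding Suc using assms(1-3) by (simp add: m_assoc)
    finally show ?case .
  qed (use assms(1-3) in simp)
  have pos: "x [^] j \<otimes> y = y \<otimes> w [^] j" if "j \<ge> 0" for j :: int
    using nat[of "nat j"] that by simp
  show ?thesis
  proof (cases "i \<ge> 0")
    case False
    then have "x [^] (- i) \<otimes> y = y \<otimes> w [^] (- i)" by (intro pos) simp
    from inv_intertwine[OF _ _ _ this] have "inv (x [^] (- i)) \<otimes> y = y \<otimes> inv (w [^] (- i))"
      using assms(1-3) by simp
    then show ?thesis using assms(1-3) by (simp add: int_pow_neg)
  qed (rule pos)
qed

lemma int_pow_mult_assoc:
  "x \<in> carrier G \<Longrightarrow> y \<in> carrier G \<Longrightarrow> x [^] (i::int) \<otimes> (x [^] (j::int) \<otimes> y) = x [^] (i + j) \<otimes> y"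
  by (simp add: int_pow_mult flip: m_assoc)

lemma int_pow_eq_one_of_dvd:
  assumes "x \<in> carrier G" "x [^] (k::int) = \<one>" "k dvd l"
  shows "x [^] l = \<one>"
  using assms by (auto simp flip: int_pow_pow)

text \<open>The odd part of x is invertible modulo 2^z, so once the odd part of the order of g is
  killed by M, every exponent with at least the 2-adic valuation of x becomes a multiple of x. The
  cofactor r is a natural number because it later serves as an index of \<open>gsum\<close>.\<close>

lemma int_pow_transfer:
  assumes g: "g \<in> carrier G" and one: "g [^] (2 ^ z * int M) = \<one>"
    and v: "val2 p x" and e: "2 ^ (p + q) dvd e"
  shows "\<exists>r::nat. 2 ^ q dvd int r \<and> g [^] (e * int M) = g [^] (x * int r)"
proof -
  obtain u where u: "odd u" "x = 2 ^ p * u" using v unfolding val2_def by blast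
  obtain e' where e': "e = 2 ^ (p + q) * e'" using e by (elim dvdE)
  have "coprime u (2 ^ z)" using u(1) by simp
  then obtain a b where ab: "a * u + b * 2 ^ z = 1" using bezout_int[of u "2 ^ z"] by auto
  define r' where "r' = nat ((a * e') mod 2 ^ z)"
  define r where "r = 2 ^ q * M * r'"
  have "2 ^ z dvd u * (a * e') - e'"
  proof -
    have "u * (a * e') - e' = (a * u - 1) * e'" by (simp add: algebra_simps)
    also have "a * u - 1 = - b * 2 ^ z" using ab by simp
    finally show ?thesis by (metis dvd_triv_left mult.assoc mult.commute)
  qed
  moreover have "2 ^ z dvd a * e' - int r'" unfolding r'_def by (simp add: minus_mod_eq_mult_div)
  ultimately have "2 ^ z dvd (u * (a * e') - e') - u * (a * e' - int r')"
      by (rule dvd_diff[OF _ dvd_mult])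
  then have "2 ^ z dvd u * int r' - e'" by (simp add: algebra_simps)
  then have "2 ^ z * int M dvd (u * int r' - e') * int M" by (intro mult_dvd_mono) auto
  moreover have "x * int r - e * int M = 2 ^ (p + q) * ((u * int r' - e') * int M)"
    unfolding u(2) e' r_def by (simp add: algebra_simps power_add)
  ultimately have "2 ^ z * int M dvd x * int r - e * int M" by simp
  from int_pow_eq_one_of_dvd[OF g one this] have "g [^] (e * int M) \<otimes> g [^] (x * int r - e * int M)
      = g [^] (e * int M)"
    using g by simp
  then have "g [^] (e * int M) = g [^] (x * int r)" using g by (simp flip: int_pow_mult)
  then show ?thesis unfolding r_def by (intro exI[of _ r]) (simp add: r_def)
qed

end

text \<open>
  The elements that some power of \<open>C\<close> conjugates into the powers of \<open>A\<close>. As long as \<open>A\<close> is not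
  known to have finite order, conjugation by the inverse of \<open>C\<close> may leave the powers of \<open>A\<close>.
\<close>

definition pow_hull :: "('g, 'm) monoid_scheme \<Rightarrow> 'g \<Rightarrow> 'g \<Rightarrow> 'g set" where
  "pow_hull G A C = {g \<in> carrier G. \<exists>(i::nat) (q::int).
     g \<otimes>\<^bsub>G\<^esub> C [^]\<^bsub>G\<^esub> int i = C [^]\<^bsub>G\<^esub> int i \<otimes>\<^bsub>G\<^esub> A [^]\<^bsub>G\<^esub> q}"

text \<open>C is a parameter rather than the term [A, B], so that exchanging A with B, \<alpha> with
  \<beta> and C with its inverse is again an instance. Through \<open>macdonald_swap\<close> each
  result about A yields its mirror image for B.\<close>

locale macdonald = group G for G (structure) +
  fixes A B C and \<alpha> \<beta> :: int
  assumes A [simp, intro]: "A \<in> carrier G" and B [simp, intro]: "B \<in> carrier G"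
    and C [simp, intro]: "C \<in> carrier G"
    and AC: "A \<otimes> C = C \<otimes> A [^] \<alpha>"
    and CB: "C \<otimes> B = B [^] \<beta> \<otimes> C"
    and AB: "A \<otimes> B = B \<otimes> A \<otimes> C"
begin

lemma macdonald_swap: "macdonald G B A (inv C) \<beta> \<alpha>"
proof unfold_locales
  show "B \<otimes> inv C = inv C \<otimes> B [^] \<beta>"
    using CB by (metis B C int_pow_closed inv_closed inv_solve_left inv_solve_right m_assoc m_closed)
  show "inv C \<otimes> A = A [^] \<alpha> \<otimes> inv C"
    using AC by (metis A C int_pow_closed inv_closed inv_solve_left inv_solve_right m_assoc m_closed)
  show "B \<otimes> A = A \<otimes> B \<otimes> inv C"
    using AB by (metis A B C inv_solve_right m_closed)
qed auto

section \<open>Conjugation by powers of C and the hull of the powers of A\<close>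

lemma A_pow_C_pow: "A [^] (q::int) \<otimes> C [^] int k = C [^] int k \<otimes> A [^] (q * \<alpha> ^ k)"
proof (induction k arbitrary: q)
  case (Suc k)
  have s: "C [^] int (Suc k) = C \<otimes> C [^] int k" using int_pow_mult[OF C, of 1 "int k"] by simp
  have "A [^] q \<otimes> C = C \<otimes> A [^] (q * \<alpha>)"
    using int_pow_intertwine[OF A C _ AC, of q] by (simp add: int_pow_pow mult.commute)
  then have "A [^] q \<otimes> C [^] int (Suc k) = C \<otimes> (A [^] (q * \<alpha>) \<otimes> C [^] int k)"
    unfolding s by (simp flip: m_assoc)
  then show ?case unfolding Suc s by (simp add: m_assoc mult.assoc)
qed simp

text \<open>The hull is the union of the groups C^i <A> C^(-i), which increase with i because A = C
  A^\<alpha> C^(-1). Enlarging i gives two elements a common i, where they multiply like powers of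
  A; hence the hull is abelian.\<close>

lemma hull_raise:
  fixes q :: int
  assumes "g \<in> carrier G" "g \<otimes> C [^] int i = C [^] int i \<otimes> A [^] q"
  shows "g \<otimes> C [^] int (i + k) = C [^] int (i + k) \<otimes> A [^] (q * \<alpha> ^ k)"
proof -
  have "g \<otimes> C [^] int (i + k) = g \<otimes> C [^] int i \<otimes> C [^] int k"
    using assms(1) by (simp add: int_pow_mult m_assoc)
  also have "\<dots> = C [^] int i \<otimes> (A [^] q \<otimes> C [^] int k)" unfolding assms(2) by (simp add: m_assoc)
  also have "\<dots> = C [^] int (i + k) \<otimes> A [^] (q * \<alpha> ^ k)"
    by (simp add: A_pow_C_pow int_pow_mult_assoc)
  finally show ?thesis .
qed

abbreviation ahull where "ahull \<equiv> pow_hull G A C"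

lemma hull_carrier [simp]: "g \<in> ahull \<Longrightarrow> g \<in> carrier G" by (simp add: pow_hull_def)

lemma hullI:
  "g \<in> carrier G \<Longrightarrow> g \<otimes> C [^] int i = C [^] int i \<otimes> A [^] (q::int) \<Longrightarrow> g \<in> ahull"
  unfolding pow_hull_def by blast

lemma hullE:
  assumes "g \<in> ahull"
  obtains i and q :: int where "g \<otimes> C [^] int i = C [^] int i \<otimes> A [^] q"
  using assms unfolding pow_hull_def by blast

lemma hull_common:
  assumes "g \<in> ahull" "h \<in> ahull"
  obtains i and q r :: int where "g \<otimes> C [^] int i = C [^] int i \<otimes> A [^] q"
    "h \<otimes> C [^] int i = C [^] int i \<otimes> A [^] r"
proof -
  obtain i q where g: "g \<otimes> C [^] int i = C [^] int i \<otimes> A [^] (q::int)" using assms(1)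
      by (rule hullE)
  obtain j r where h: "h \<otimes> C [^] int j = C [^] int j \<otimes> A [^] (r::int)" using assms(2)
      by (rule hullE)
  show ?thesis
    using hull_raise[OF hull_carrier[OF assms(1)] g, of j]
      hull_raise[OF hull_carrier[OF assms(2)] h, of i, unfolded add.commute[of j i]]
    by (rule that)
qed

lemma A_pow_hull [simp]: "A [^] (q::int) \<in> ahull"
  by (rule hullI[of _ 0 q]) auto

lemma hull_mult_eq:
  assumes "g \<in> carrier G" "h \<in> carrier G" "g \<otimes> C [^] int i = C [^] int i \<otimes> A [^] (q::int)"
    "h \<otimes> C [^] int i = C [^] int i \<otimes> A [^] (r::int)"
  shows "g \<otimes> h \<otimes> C [^] int i = C [^] int i \<otimes> A [^] (q + r)"
proof -
  have "g \<otimes> h \<otimes> C [^] int i = g \<otimes> (h \<otimes> C [^] int i)" using assms(1,2) by (simp add: m_assoc)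
  also have "\<dots> = (g \<otimes> C [^] int i) \<otimes> A [^] r" unfolding assms(4) using assms(1,2)
      by (simp add: m_assoc)
  also have "\<dots> = C [^] int i \<otimes> A [^] (q + r)" unfolding assms(3) by (simp add: m_assoc int_pow_mult)
  finally show ?thesis .
qed

lemma hull_mult [simp]: "g \<in> ahull \<Longrightarrow> h \<in> ahull \<Longrightarrow> g \<otimes> h \<in> ahull"
proof -
  assume gh: "g \<in> ahull" "h \<in> ahull"
  then obtain i q r where "g \<otimes> C [^] int i = C [^] int i \<otimes> A [^] (q::int)"
    "h \<otimes> C [^] int i = C [^] int i \<otimes> A [^] (r::int)" by (rule hull_common)
  from hull_mult_eq[OF _ _ this] gh show ?thesis by (intro hullI) auto
qed

lemma hull_commute: "g \<in> ahull \<Longrightarrow> h \<in> ahull \<Longrightarrow> g \<otimes> h = h \<otimes> g"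
proof -
  assume gh: "g \<in> ahull" "h \<in> ahull"
  then obtain i q r where 1: "g \<otimes> C [^] int i = C [^] int i \<otimes> A [^] (q::int)"
    "h \<otimes> C [^] int i = C [^] int i \<otimes> A [^] (r::int)" by (rule hull_common)
  then have "(g \<otimes> h) \<otimes> C [^] int i = (h \<otimes> g) \<otimes> C [^] int i"
    using hull_mult_eq[of g h i q r] hull_mult_eq[of h g i r q] gh by (simp add: add.commute)
  then show ?thesis using gh by (simp add: r_cancel)
qed

lemma hull_int_pow [simp]: "g \<in> ahull \<Longrightarrow> g [^] (k::int) \<in> ahull"
proof -
  assume g: "g \<in> ahull"
  then obtain i q where "g \<otimes> C [^] int i = C [^] int i \<otimes> A [^] (q::int)" by (rule hullE)
  then have "g [^] k \<otimes> C [^] int i = C [^] int i \<otimes> (A [^] q) [^] k"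
    using g by (intro int_pow_intertwine) auto
  then show ?thesis using g by (intro hullI[of _ i "q * k"]) (auto simp: int_pow_pow)
qed

lemma hull_inv [simp]: "g \<in> ahull \<Longrightarrow> inv g \<in> ahull"
  using hull_int_pow[of g "-1"] by (simp add: int_pow_neg)

lemma hull_conj:
  assumes g: "g \<in> ahull"
  shows "C [^] (- j :: int) \<otimes> g \<otimes> C [^] j \<in> ahull"
proof -
  obtain i q where i: "g \<otimes> C [^] int i = C [^] int i \<otimes> A [^] (q::int)" using g by (rule hullE)
  \<comment> \<open>Chosen such that the conjugated element has witness i' and both i' and i + k = j
    + i' are natural numbers whatever the sign of j.\<close>
  define i' k where "i' = i + nat \<bar>j\<bar>" and "k = nat (\<bar>j\<bar> + j)"
  have ik: "j + int i' = int (i + k)" "- j + int (i + k) = int i'" by (auto simp: i'_def k_def)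
  have "(C [^] (- j) \<otimes> g \<otimes> C [^] j) \<otimes> C [^] int i' = C [^] (- j) \<otimes> (g \<otimes> C [^] (j + int i'))"
    using g by (simp add: m_assoc int_pow_mult)
  also have "\<dots> = C [^] (- j) \<otimes> (C [^] int (i + k) \<otimes> A [^] (q * \<alpha> ^ k))"
    unfolding ik(1) using hull_raise[OF _ i, of k] g by simp
  also have "\<dots> = C [^] int i' \<otimes> A [^] (q * \<alpha> ^ k)"
    by (subst int_pow_mult_assoc) (use ik(2) in \<open>simp_all del: of_nat_add\<close>)
  finally show ?thesis using g by (intro hullI) auto
qed

lemma hull_conj':
  assumes "g \<in> ahull"
  shows "\<exists>h \<in> ahull. g \<otimes> C [^] (j::int) = C [^] j \<otimes> h"
  using hull_conj[OF assms, of j] assms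
  by (intro bexI[of _ "C [^] (- j) \<otimes> g \<otimes> C [^] j"]) (auto simp: m_assoc int_pow_mult_assoc)

lemma hull_conj_pow:
  assumes "g \<in> ahull"
  shows "\<exists>(j::int) (q::int). g \<otimes> C [^] j = C [^] j \<otimes> A [^] q"
  using assms unfolding pow_hull_def by blast

text \<open>All powers of C normalise the hull, so in a product of copies of C^d h the powers of C
  can be collected on the left.\<close>

lemma pow_mult_hull:
  assumes h: "h \<in> ahull"
  shows "\<exists>g \<in> ahull. (C [^] (d::int) \<otimes> h) [^] (k::int) = C [^] (d * k) \<otimes> g"
proof -
  have nat: "\<exists>g \<in> ahull. (C [^] d \<otimes> h) [^] (k::nat) = C [^] (d * int k) \<otimes> g" for k
  proof (induction k)
    case 0
    then show ?case using A_pow_hull[of 0] by force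
  next
    case (Suc k)
    then obtain g where g: "g \<in> ahull" "(C [^] d \<otimes> h) [^] k = C [^] (d * int k) \<otimes> g" by blast
    obtain g' where g': "g' \<in> ahull" "g \<otimes> C [^] d = C [^] d \<otimes> g'" using hull_conj'[OF g(1)] by blast
    have "(C [^] d \<otimes> h) [^] Suc k = C [^] (d * int k) \<otimes> (g \<otimes> C [^] d) \<otimes> h"
      using g h by (simp add: m_assoc)
    also have "\<dots> = C [^] (d * int (Suc k)) \<otimes> (g' \<otimes> h)"
      unfolding g'(2) using g'(1) h by (simp add: m_assoc int_pow_mult_assoc algebra_simps)
    finally show ?case using hull_mult[OF g'(1) h] by (rule bexI)
  qed
  have pos: "\<exists>g \<in> ahull. (C [^] d \<otimes> h) [^] k = C [^] (d * k) \<otimes> g" if "k \<ge> 0" for k :: int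
    using nat[of "nat k"] that by simp
  show ?thesis
  proof (cases "k \<ge> 0")
    case False
    then obtain g where g: "g \<in> ahull" "(C [^] d \<otimes> h) [^] (- k) = C [^] (d * (- k)) \<otimes> g"
      using pos[of "- k"] by auto
    have "(C [^] d \<otimes> h) [^] k = inv ((C [^] d \<otimes> h) [^] (- k))"
      using h by (simp add: int_pow_neg)
    also have "\<dots> = inv g \<otimes> C [^] (d * k)"
      unfolding g(2) using g(1) by (simp add: inv_mult_group flip: int_pow_neg)
    finally have "(C [^] d \<otimes> h) [^] k = inv g \<otimes> C [^] (d * k)" .
    then show ?thesis using hull_conj'[OF hull_inv[OF g(1)]] by simp
  qed (rule pos)
qed

text \<open>The first evaluation. Since B^\<beta> = C B C^(-1), conjugating A by B^\<beta> can be
  done in three stages: C turns A into A^\<alpha>, B turns this into (A C)^\<alpha>, and the inverse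
  of C turns A C into C A.\<close>

lemma A_pow_B_pow_beta: "A \<otimes> B [^] \<beta> = B [^] \<beta> \<otimes> (C \<otimes> A) [^] \<alpha>"
proof -
  have 1: "A [^] \<alpha> \<otimes> B = B \<otimes> (A \<otimes> C) [^] \<alpha>"
    by (rule int_pow_intertwine) (auto simp: AB m_assoc)
  have 2: "(C \<otimes> A) [^] \<alpha> \<otimes> C = C \<otimes> (A \<otimes> C) [^] \<alpha>"
    by (rule int_pow_intertwine) (auto simp: m_assoc)
  have "A \<otimes> B [^] \<beta> \<otimes> C = A \<otimes> C \<otimes> B" using CB by (simp add: m_assoc)
  also have "\<dots> = C \<otimes> (A [^] \<alpha> \<otimes> B)" by (simp add: AC m_assoc)
  also have "\<dots> = (C \<otimes> B) \<otimes> (A \<otimes> C) [^] \<alpha>" by (simp add: 1 m_assoc)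
  also have "\<dots> = B [^] \<beta> \<otimes> (C \<otimes> A) [^] \<alpha> \<otimes> C" by (simp add: CB 2 m_assoc)
  finally show ?thesis by (subst (asm) r_cancel) auto
qed

lemma B_pow_A: "B [^] (k::int) \<otimes> A = A \<otimes> (B \<otimes> inv C) [^] k"
  by (rule int_pow_intertwine) (auto simp: macdonald.AB[OF macdonald_swap] m_assoc)

lemma B_invC_pow: "(B \<otimes> inv C) [^] (k::int) \<otimes> C = C \<otimes> (inv C \<otimes> B) [^] k"
proof (rule int_pow_intertwine)
  have "B \<otimes> inv C \<otimes> C = B" "C \<otimes> (inv C \<otimes> B) = B"
    by (simp add: m_assoc, simp flip: m_assoc)
  then show "B \<otimes> inv C \<otimes> C = C \<otimes> (inv C \<otimes> B)" by simp
qed auto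

end

section \<open>Finiteness of the orders of the generators\<close>

definition (in group) torsion :: "'a \<Rightarrow> bool" where
  "torsion g \<longleftrightarrow> (\<exists>k::nat. k > 0 \<and> g [^] int k = \<one>)"

lemma (in group) l_cancelD:
  "c \<in> carrier G \<Longrightarrow> x \<in> carrier G \<Longrightarrow> y \<in> carrier G \<Longrightarrow> c \<otimes> x = c \<otimes> y \<Longrightarrow> x = y"
  by simp

lemma (in group) torsionI:
  assumes "g \<in> carrier G" "e \<noteq> 0" "g [^] (e::int) = \<one>"
  shows "torsion g"
  unfolding torsion_def
  using int_pow_eq_one_of_dvd[OF assms(1,3), of "\<bar>e\<bar>"] assms(2) by (intro exI[of _ "nat \<bar>e\<bar>"]) auto

lemma (in group) torsion_of_int_pow:
  assumes "g \<in> carrier G" "(e::int) \<noteq> 0" "torsion (g [^] e)"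
  shows "torsion g"
proof -
  obtain k :: nat where "k > 0" "g [^] (e * int k) = \<one>"
    using assms by (auto simp: torsion_def int_pow_pow)
  then show ?thesis using assms by (intro torsionI[of g "e * int k"]) auto
qed

lemma (in group) torsion_one: "torsion \<one>"
  unfolding torsion_def by (intro exI[of _ 1]) simp

lemma (in group) torsion_int_pow: "g \<in> carrier G \<Longrightarrow> torsion g \<Longrightarrow> torsion (g [^] (i::int))"
  unfolding torsion_def by (metis int_pow_one int_pow_pow mult.commute)

lemma (in group) torsion_inv: "g \<in> carrier G \<Longrightarrow> torsion g \<Longrightarrow> torsion (inv g)"
  using torsion_int_pow[of g "- 1"] by (simp add: int_pow_neg)

lemma abs_ge_2_pow_neq_1: "\<bar>q::int\<bar> \<ge> 2 \<Longrightarrow> k > 0 \<Longrightarrow> q ^ k \<noteq> 1"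
  by (metis abs_1 abs_ge_zero less_le_not_le not_one_le_zero one_less_power power_abs order_less_le_trans one_less_numeral_iff semiring_norm(76))

context macdonald
begin

lemma C_pow_inv: "(inv C) [^] (j::int) = C [^] (- j)"
  by (simp add: int_pow_inv int_pow_neg)

text \<open>Equating \<open>A_pow_B_pow_beta\<close> with \<open>B_pow_A\<close> gives (C
  A)^\<alpha> = A (B C^(-1))^(-\<beta>) B^\<beta>. Collecting C puts the left side into C^\<alpha>
  times the hull of A and the right side into A C^\<beta> times the hull of B. The hull factors are
  not computed, so \<alpha> and \<beta> may have any sign.\<close>

lemma hull_relation:
  "\<exists>g \<in> ahull. \<exists>h \<in> pow_hull G B (inv C). C [^] (\<alpha> - \<beta>) \<otimes> g = h"
proof -
  interpret S: macdonald G B A "inv C" \<beta> \<alpha> by (rule macdonald_swap)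
  define W where "W = B \<otimes> inv C"
  have W: "W \<in> carrier G" by (simp add: W_def)
  obtain g where g: "g \<in> ahull" "(C \<otimes> A) [^] \<alpha> = C [^] \<alpha> \<otimes> g"
    using pow_mult_hull[OF A_pow_hull[of 1], of 1 \<alpha>] by auto
  obtain h where h: "h \<in> S.ahull" "(inv C \<otimes> B) [^] (- \<beta>) = C [^] \<beta> \<otimes> h"
    using S.pow_mult_hull[OF S.A_pow_hull[of 1], of 1 "- \<beta>"] by (auto simp: C_pow_inv int_pow_neg)
  obtain h' where h': "h' \<in> S.ahull" "h \<otimes> C [^] (- 1 :: int) = C [^] (- 1 :: int) \<otimes> h'"
    using S.hull_conj'[OF h(1), of 1] by (auto simp: C_pow_inv int_pow_neg)
  have c: "g \<in> carrier G" "h \<in> carrier G" "h' \<in> carrier G" using g h h' by auto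
  obtain g' where g': "g' \<in> ahull" "A [^] (- 1 :: int) \<otimes> C [^] \<alpha> = C [^] \<alpha> \<otimes> g'"
    using hull_conj'[OF A_pow_hull[of "- 1"], of \<alpha>] by auto
  have "W [^] (- \<beta>) = W [^] (- \<beta>) \<otimes> C \<otimes> C [^] (- 1 :: int)"
    using W by (simp add: m_assoc int_pow_neg)
  also have "\<dots> = C \<otimes> (C [^] \<beta> \<otimes> h) \<otimes> C [^] (- 1 :: int)"
    unfolding W_def B_invC_pow h(2) ..
  also have "\<dots> = C \<otimes> C [^] \<beta> \<otimes> (h \<otimes> C [^] (- 1 :: int))" using c by (simp add: m_assoc)
  also have "\<dots> = C [^] (1 :: int) \<otimes> (C [^] \<beta> \<otimes> (C [^] (- 1 :: int) \<otimes> h'))"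
    unfolding h'(2) using c by (simp add: m_assoc)
  also have "\<dots> = C [^] \<beta> \<otimes> h'" using c(3) by (simp add: int_pow_mult_assoc del: int_pow_1)
  finally have Wh: "W [^] (- \<beta>) = C [^] \<beta> \<otimes> h'" .
  have "B [^] \<beta> \<otimes> (C [^] \<alpha> \<otimes> g) = A \<otimes> B [^] \<beta>"
    unfolding A_pow_B_pow_beta g(2) ..
  also have "\<dots> = A \<otimes> W [^] \<beta> \<otimes> W [^] (- \<beta>) \<otimes> B [^] \<beta>"
    using W by (simp add: m_assoc int_pow_mult_assoc)
  also have "\<dots> = B [^] \<beta> \<otimes> (A \<otimes> W [^] (- \<beta>) \<otimes> B [^] \<beta>)"
    unfolding B_pow_A[of \<beta>, folded W_def, symmetric] using W by (simp add: m_assoc)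
  finally have "C [^] \<alpha> \<otimes> g = A \<otimes> W [^] (- \<beta>) \<otimes> B [^] \<beta>"
    by (rule l_cancelD[rotated 3]) (use W c in simp_all)
  then have "A [^] (- 1 :: int) \<otimes> (C [^] \<alpha> \<otimes> g)
      = A [^] (- 1 :: int) \<otimes> (A [^] (1 :: int) \<otimes> (W [^] (- \<beta>) \<otimes> B [^] \<beta>))"
    using W by (simp add: m_assoc)
  also have "\<dots> = C [^] \<beta> \<otimes> (h' \<otimes> B [^] \<beta>)"
    using W c by (simp add: int_pow_mult_assoc[of A] Wh m_assoc del: int_pow_1)
  also have "A [^] (- 1 :: int) \<otimes> (C [^] \<alpha> \<otimes> g) = C [^] \<alpha> \<otimes> (g' \<otimes> g)"
    using c g'(1) by (simp add: g'(2) m_assoc flip: m_assoc[of "A [^] (- 1 :: int)"])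
  finally have "C [^] (- \<beta>) \<otimes> (C [^] \<alpha> \<otimes> (g' \<otimes> g)) = C [^] (- \<beta>) \<otimes> (C [^] \<beta> \<otimes> (h' \<otimes> B [^] \<beta>))"
    by simp
  then have "C [^] (\<alpha> - \<beta>) \<otimes> (g' \<otimes> g) = h' \<otimes> B [^] \<beta>"
    using c g'(1) by (simp add: int_pow_mult_assoc)
  then show ?thesis using hull_mult[OF g'(1) g(1)] S.hull_mult[OF h'(1) S.A_pow_hull] by blast
qed

text \<open>Conjugation by a suitable power of C turns the element of the hull of B into a power of
  B. It fixes C^(\<alpha> - \<beta>) and preserves the hull of A.\<close>

lemma hull_relation_B:
  "\<exists>x::int. \<exists>g \<in> ahull. C [^] (\<alpha> - \<beta>) \<otimes> g = B [^] x"
proof -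
  interpret S: macdonald G B A "inv C" \<beta> \<alpha> by (rule macdonald_swap)
  obtain g h where g: "g \<in> ahull" "h \<in> S.ahull" "C [^] (\<alpha> - \<beta>) \<otimes> g = h"
    using hull_relation by blast
  obtain j q where "h \<otimes> (inv C) [^] (j::int) = (inv C) [^] j \<otimes> B [^] (q::int)"
    using S.hull_conj_pow[OF g(2)] by blast
  then have j: "h \<otimes> C [^] (- j) = C [^] (- j) \<otimes> B [^] q" by (simp only: C_pow_inv)
  obtain g' where g': "g' \<in> ahull" "g \<otimes> C [^] (- j) = C [^] (- j) \<otimes> g'" using hull_conj'[OF g(1)]
      by blast
  have "C [^] (- j) \<otimes> (C [^] (\<alpha> - \<beta>) \<otimes> g') = C [^] (\<alpha> - \<beta>) \<otimes> (C [^] (- j) \<otimes> g')"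
    using g'(1) by (simp add: int_pow_mult_assoc add.commute)
  also have "\<dots> = h \<otimes> C [^] (- j)" using g(1) by (simp add: m_assoc flip: g'(2) g(3))
  finally have "C [^] (\<alpha> - \<beta>) \<otimes> g' = B [^] q"
    unfolding j by (rule l_cancelD[rotated 3]) (use g'(1) in simp_all)
  then show ?thesis using g'(1) by blast
qed

lemma hull_torsion:
  assumes "torsion A" "g \<in> ahull"
  shows "torsion g"
proof -
  obtain k where k: "k > 0" "A [^] int k = \<one>" using assms by (auto simp: torsion_def)
  obtain i q where "g \<otimes> C [^] int i = C [^] int i \<otimes> A [^] (q::int)" using assms(2) by (rule hullE)
  then have "g [^] int k \<otimes> C [^] int i = C [^] int i \<otimes> (A [^] q) [^] int k"
    using assms(2) by (intro int_pow_intertwine) auto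
  moreover have "(A [^] q) [^] int k = \<one>"
    using k by (metis A int_pow_one int_pow_pow mult.commute)
  ultimately have "g [^] int k \<otimes> C [^] int i = \<one> \<otimes> C [^] int i" by simp
  then have "g [^] int k = \<one>" using assms(2) by (subst (asm) r_cancel) auto
  then show ?thesis using k unfolding torsion_def by blast
qed

lemma A_torsion_of_C:
  assumes "torsion C" "\<bar>\<alpha>\<bar> \<ge> 2"
  shows "torsion A"
proof -
  obtain k where k: "k > 0" "C [^] int k = \<one>" using assms by (auto simp: torsion_def)
  have "A = A [^] (\<alpha> ^ k)" using A_pow_C_pow[of 1 k] k by simp
  then have "A [^] (\<alpha> ^ k - 1) = \<one>" using int_pow_diff[OF A, of "\<alpha> ^ k" 1] by simp
  then show ?thesis using abs_ge_2_pow_neq_1[OF assms(2) k(1)] by (intro torsionI) auto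
qed

lemma C_torsion_of_relation:
  assumes "torsion A" "torsion w" "d \<noteq> 0" "g \<in> ahull" "C [^] (d::int) \<otimes> g = w"
  shows "torsion C"
proof -
  obtain k where k: "k > 0" "w [^] int k = \<one>" using assms by (auto simp: torsion_def)
  obtain h where h: "h \<in> ahull" "(C [^] d \<otimes> g) [^] int k = C [^] (d * int k) \<otimes> h"
    using pow_mult_hull[OF assms(4)] by blast
  then have "C [^] (d * int k) \<otimes> h = \<one>" using k(2) assms(5) by simp
  then have "C [^] (d * int k) = inv h" using h
      by (metis C hull_carrier int_pow_closed inv_equality inv_inv)
  moreover have "torsion (inv h)" using hull_torsion[OF assms(1) hull_inv[OF h(1)]] .
  ultimately show ?thesis using k assms by (intro torsion_of_int_pow[of C "d * int k"]) auto
qed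

text \<open>The factor g commutes with A because the hull is abelian, so w acts on A as C^d
  does.\<close>

lemma intertwine_of_relation:
  assumes "g \<in> ahull" "C [^] int d \<otimes> g = w"
  shows "A \<otimes> w = w \<otimes> A [^] (\<alpha> ^ d)"
proof -
  have "A \<otimes> w = (A [^] (1::int) \<otimes> C [^] int d) \<otimes> g" using assms(1)
      by (simp add: m_assoc flip: assms(2))
  also have "\<dots> = C [^] int d \<otimes> (A [^] (\<alpha> ^ d) \<otimes> g)"
    unfolding A_pow_C_pow using assms(1) by (simp add: m_assoc)
  also have "\<dots> = w \<otimes> A [^] (\<alpha> ^ d)"
    using assms(1) by (simp add: hull_commute[OF A_pow_hull assms(1)] m_assoc flip: assms(2))
  finally show ?thesis .
qed

text \<open>
  A power of \<open>B\<close> normalises the powers of \<open>A\<close> and vice versa, so that the commutator of the two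
  powers is a power of \<open>A\<close> and a power of \<open>B\<close>; it is therefore central, commutes with \<open>C\<close>, and
  is killed by \<open>\<alpha> - 1\<close>.
\<close>

lemma all_torsion_aux:
  assumes a: "\<bar>\<alpha>\<bar> \<ge> 2" and b: "\<bar>\<beta>\<bar> \<ge> 2" and less: "\<beta> < \<alpha>"
  shows "torsion A \<and> torsion B \<and> torsion C"
proof -
  interpret S: macdonald G B A "inv C" \<beta> \<alpha> by (rule macdonald_swap)
  define d where "d = nat (\<alpha> - \<beta>)"
  have d: "int d = \<alpha> - \<beta>" "d > 0" using less by (auto simp: d_def)
  obtain x g where xg: "g \<in> ahull" "C [^] int d \<otimes> g = B [^] (x::int)"
    using hull_relation_B d by auto
  obtain y' h' where yh': "h' \<in> S.ahull" "C [^] int d \<otimes> h' = A [^] (y'::int)"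
    using S.hull_relation_B d by (auto simp: C_pow_inv)
  obtain h where h: "h \<in> S.ahull" "inv h' \<otimes> (inv C) [^] int d = (inv C) [^] int d \<otimes> h"
    using S.hull_conj'[OF S.hull_inv[OF yh'(1)]] by blast
  \<comment> \<open>The mirrored hull relation also comes out with C^d, whereas its intertwining
    lemma needs a positive power of the inverse of C. Passing to inverses repairs this and negates
    the exponent.\<close>
  define y where "y = - y'"
  have "A [^] y = inv (C [^] int d \<otimes> h')" unfolding yh'(2) by (simp add: y_def int_pow_neg)
  also have "\<dots> = inv h' \<otimes> (inv C) [^] int d" using yh'(1) by (simp add: inv_mult_group int_pow_inv)
  finally have yh: "(inv C) [^] int d \<otimes> h = A [^] y" using h(2) by simp
  have f1: "A \<otimes> B [^] x = B [^] x \<otimes> A [^] (\<alpha> ^ d)" by (rule intertwine_of_relation[OF xg])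
  have f2: "B \<otimes> A [^] y = A [^] y \<otimes> B [^] (\<beta> ^ d)" by (rule S.intertwine_of_relation[OF h(1) yh])
  \<comment> \<open>By \<open>f1\<close> the commutator of A^y and B^x is A^w, and by
    \<open>f2\<close> it is B^(-v).\<close>
  define w v where "w = y * (\<alpha> ^ d - 1)" and "v = x * (\<beta> ^ d - 1)"
  have e1: "A [^] y \<otimes> B [^] x = B [^] x \<otimes> A [^] (\<alpha> ^ d * y)"
    using int_pow_intertwine[OF _ _ _ f1, of y] by (simp add: int_pow_pow)
  have e2: "B [^] x \<otimes> A [^] y = A [^] y \<otimes> B [^] (\<beta> ^ d * x)"
    using int_pow_intertwine[OF _ _ _ f2, of x] by (simp add: int_pow_pow)
  have "A [^] y \<otimes> B [^] x = (B [^] x \<otimes> A [^] y) \<otimes> A [^] w"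
    unfolding e1 by (simp add: m_assoc w_def algebra_simps flip: int_pow_mult)
  also have "\<dots> = A [^] y \<otimes> (B [^] (\<beta> ^ d * x) \<otimes> A [^] w)" unfolding e2 by (simp add: m_assoc)
  finally have "B [^] x = B [^] (\<beta> ^ d * x) \<otimes> A [^] w"
    by (rule l_cancelD[rotated 3]) simp_all
  then have "B [^] (- (\<beta> ^ d * x)) \<otimes> B [^] x
      = B [^] (- (\<beta> ^ d * x)) \<otimes> (B [^] (\<beta> ^ d * x) \<otimes> A [^] w)" by simp
  then have z: "A [^] w = B [^] (- v)"
    by (simp add: int_pow_mult_assoc v_def algebra_simps flip: int_pow_mult)
  have zB: "A [^] w \<otimes> B = B \<otimes> A [^] w"
    unfolding z using int_pow_mult[OF B, of 1 "- v"] int_pow_mult[OF B, of "- v" 1]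
        by (simp add: add.commute)
  have zA: "A [^] w \<otimes> A = A \<otimes> A [^] w"
    using int_pow_mult[OF A, of 1 "w"] int_pow_mult[OF A, of "w" 1] by (simp add: add.commute)
  have "B \<otimes> A \<otimes> (A [^] w \<otimes> C) = B \<otimes> A [^] w \<otimes> A \<otimes> C"
      by (simp add: m_assoc flip: zA) (simp add: zA flip: m_assoc)
  also have "\<dots> = A [^] w \<otimes> (A \<otimes> B)" unfolding zB[symmetric] AB by (simp add: m_assoc)
  also have "\<dots> = A \<otimes> (A [^] w \<otimes> B)" by (simp add: zA flip: m_assoc)
  also have "\<dots> = B \<otimes> A \<otimes> (C \<otimes> A [^] w)" unfolding zB using AB by (simp flip: m_assoc)
  finally have zC: "A [^] w \<otimes> C = C \<otimes> A [^] w" by (rule l_cancelD[rotated 3]) simp_all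
  have "C \<otimes> A [^] (w * \<alpha>) = C \<otimes> A [^] w" using A_pow_C_pow[of w 1] zC by simp
  then have "A [^] (w * \<alpha>) = A [^] w" by (rule l_cancelD[rotated 3]) simp_all
  then have A1: "A [^] (w * (\<alpha> - 1)) = \<one>" using int_pow_diff[OF A, of "w * \<alpha>" w]
      by (simp add: algebra_simps)
  have "B [^] (- v) \<otimes> inv C = inv C \<otimes> B [^] (- v)"
    using zC unfolding z by (metis B C int_pow_closed inv_intertwine)
  then have "inv C \<otimes> B [^] (- v * \<beta>) = inv C \<otimes> B [^] (- v)" using S.A_pow_C_pow[of "- v" 1] by simp
  then have "B [^] (- v * \<beta>) = B [^] (- v)" by (rule l_cancelD[rotated 3]) simp_all
  then have B1: "B [^] (- v * (\<beta> - 1)) = \<one>"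
    using int_pow_diff[OF B, of "- v * \<beta>" "- v"] by (simp add: algebra_simps)
  have pa: "\<alpha> ^ d \<noteq> 1" "\<beta> ^ d \<noteq> 1" using abs_ge_2_pow_neq_1 a b d(2) by auto
  have A2: "torsion A" if "y \<noteq> 0" using A1 that pa a
      by (intro torsionI[of A "w * (\<alpha> - 1)"]) (auto simp: w_def)
  have B2: "torsion B" if "x \<noteq> 0" using B1 that pa b
      by (intro torsionI[of B "- v * (\<beta> - 1)"]) (auto simp: v_def)
  \<comment> \<open>For y = 0 also w = 0, and \<open>A1\<close> says nothing about A. But then the
    conjugating element in \<open>f2\<close> is trivial, which bounds the order of B instead.
    \<open>A3\<close> is the mirror case.\<close>
  have B3: "torsion B" if "y = 0"
  proof -
    have "B = B [^] (\<beta> ^ d)" using f2 that by simp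
    then have "B [^] (\<beta> ^ d - 1) = \<one>" using int_pow_diff[OF B, of "\<beta> ^ d" 1] by simp
    then show ?thesis using pa by (intro torsionI) auto
  qed
  have A3: "torsion A" if "x = 0"
  proof -
    have "A = A [^] (\<alpha> ^ d)" using f1 that by simp
    then have "A [^] (\<alpha> ^ d - 1) = \<one>" using int_pow_diff[OF A, of "\<alpha> ^ d" 1] by simp
    then show ?thesis using pa by (intro torsionI) auto
  qed
  \<comment> \<open>For x = 0 the relation \<open>xg\<close> places C^d in the hull of the torsion
    element A, so C is torsion; as C acts on B by raising to the power \<beta>, B is torsion as
    well. The case y = 0 is symmetric.\<close>
  have "torsion A \<and> torsion B"
  proof (cases "x = 0")
    case True
    then have "torsion C"
      using C_torsion_of_relation[OF A3 torsion_one _ xg(1), of "int d"] xg(2) d by simp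
    then show ?thesis using S.A_torsion_of_C[OF torsion_inv[OF C] b] A3 True by simp
  next
    case False
    show ?thesis
    proof (cases "y = 0")
      case True
      then have "torsion (inv C)"
        using S.C_torsion_of_relation[OF B3 torsion_one _ h(1), of "int d"] yh d by simp
      then show ?thesis using A_torsion_of_C[OF _ a] torsion_inv[of "inv C"] B3 True by simp
    qed (use A2 B2 False in simp)
  qed
  moreover from this have "torsion C"
    using C_torsion_of_relation[OF _ torsion_int_pow _ xg] d by simp
  ultimately show ?thesis by simp
qed

end

section \<open>Relations with controlled two-adic valuations\<close>

lemma (in group) r_cancelD:
  "c \<in> carrier G \<Longrightarrow> x \<in> carrier G \<Longrightarrow> y \<in> carrier G \<Longrightarrow> x \<otimes> c = y \<otimes> c \<Longrightarrow> x = y"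
  by simp

lemma (in group) torsion_decompose:
  assumes "torsion g"
  obtains z M where "odd M" "g [^] (2 ^ z * int M) = \<one>"
proof -
  obtain k where k: "k > 0" "g [^] int k = \<one>" using assms by (auto simp: torsion_def)
  then obtain M where "k = 2 ^ multiplicity 2 k * M" "\<not> 2 dvd M"
    using multiplicity_decompose'[of k "2::nat"] by auto
  then show ?thesis using k(2) that[of M "multiplicity 2 k"]
      by (metis of_nat_mult of_nat_numeral of_nat_power)
qed

context macdonald
begin

lemma all_torsion:
  assumes "\<bar>\<alpha>\<bar> \<ge> 2" "\<bar>\<beta>\<bar> \<ge> 2" "\<alpha> \<noteq> \<beta>"
  shows "torsion A" "torsion B" "torsion C"
proof -
  have "torsion A \<and> torsion B \<and> torsion C"
  proof (cases "\<beta> < \<alpha>")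
    case False
    then show ?thesis
      using macdonald.all_torsion_aux[OF macdonald_swap] assms torsion_inv[of "inv C"] by auto
  qed (use assms all_torsion_aux in simp)
  then show "torsion A" "torsion B" "torsion C" by auto
qed

section \<open>Explicit collection formulas and the relations drawn from them\<close>

lemma C_A_pow:
  "(C [^] int d \<otimes> A [^] y) [^] int k = C [^] (int d * int k) \<otimes> A [^] (y * gsum (\<alpha> ^ d) k)"
proof (induction k)
  case (Suc k)
  have "(C [^] int d \<otimes> A [^] y) [^] int (Suc k)
      = (C [^] int d \<otimes> A [^] y) [^] int k \<otimes> (C [^] int d \<otimes> A [^] y)"
    using int_pow_mult[of "C [^] int d \<otimes> A [^] y" "int k" 1] by (simp add: add.commute)
  also have "\<dots> = C [^] (int d * int k) \<otimes> (A [^] (y * gsum (\<alpha> ^ d) k) \<otimes> C [^] int d) \<otimes> A [^] y"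
    unfolding Suc by (simp add: m_assoc)
  also have "\<dots> = C [^] (int d * int k + int d) \<otimes> A [^] (y * gsum (\<alpha> ^ d) k * \<alpha> ^ d + y)"
    unfolding A_pow_C_pow by (simp add: m_assoc int_pow_mult)
  finally show ?case by (simp add: gsum_Suc' algebra_simps)
qed simp

lemma C_pow_B_pow: "C [^] int k \<otimes> B [^] (q::int) = B [^] (q * \<beta> ^ k) \<otimes> C [^] int k"
proof -
  have "B [^] q \<otimes> C [^] (- int k) = C [^] (- int k) \<otimes> B [^] (q * \<beta> ^ k)"
    using macdonald.A_pow_C_pow[OF macdonald_swap, of q k] by (simp add: C_pow_inv)
  then have "C [^] int k \<otimes> (B [^] q \<otimes> C [^] (- int k)) \<otimes> C [^] int k
      = C [^] int k \<otimes> (C [^] (- int k) \<otimes> B [^] (q * \<beta> ^ k)) \<otimes> C [^] int k" by simp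
  then show ?thesis by (simp add: m_assoc int_pow_mult_assoc flip: int_pow_mult)
qed

text \<open>The second evaluation in explicit form: B^k A = A (B C^(-1))^k, with all powers of C
  collected to the left. It gives the commutator formula \<open>A_B_pow\<close> and also lets A pass
  B^k in the normal form of the group elements.\<close>

lemma B_pow_A_normal: "B [^] int k \<otimes> A = A \<otimes> C [^] (- int k) \<otimes> B [^] (\<beta> * gsum \<beta> k)"
proof -
  have 1: "(inv C \<otimes> B) [^] int k = C [^] (- int k) \<otimes> B [^] gsum \<beta> k"
    using macdonald.C_A_pow[OF macdonald_swap, of 1 1 k] by (simp add: C_pow_inv int_pow_neg)
  have "(B \<otimes> inv C) [^] int k \<otimes> C = C [^] (1::int) \<otimes> (C [^] (- int k) \<otimes> B [^] gsum \<beta> k)"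
    unfolding B_invC_pow 1 by simp
  also have "\<dots> = C [^] (- int k) \<otimes> (C [^] (1::int) \<otimes> B [^] gsum \<beta> k)"
    by (simp add: int_pow_mult_assoc add.commute del: int_pow_1)
  also have "\<dots> = (C [^] (- int k) \<otimes> B [^] (\<beta> * gsum \<beta> k)) \<otimes> C"
    using C_pow_B_pow[of 1 "gsum \<beta> k"] by (simp add: m_assoc mult.commute)
  finally have "(B \<otimes> inv C) [^] int k = C [^] (- int k) \<otimes> B [^] (\<beta> * gsum \<beta> k)"
    by (rule r_cancelD[rotated 3]) simp_all
  then show ?thesis unfolding B_pow_A by (simp add: m_assoc)
qed

lemma A_B_pow:
  "A \<otimes> B [^] int k = B [^] int k \<otimes> (A \<otimes> (B [^] (int k * \<beta> ^ k - \<beta> * gsum \<beta> k) \<otimes> C [^] int k))"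
proof -
  have "B [^] int k \<otimes> (A \<otimes> (B [^] (int k * \<beta> ^ k - \<beta> * gsum \<beta> k) \<otimes> C [^] int k))
      = (B [^] int k \<otimes> A) \<otimes> B [^] (int k * \<beta> ^ k - \<beta> * gsum \<beta> k) \<otimes> C [^] int k" by (simp add: m_assoc)
  also have "\<dots> = A \<otimes> C [^] (- int k) \<otimes> (B [^] (int k * \<beta> ^ k) \<otimes> C [^] int k)"
    unfolding B_pow_A_normal by (simp add: m_assoc int_pow_mult_assoc)
  also have "\<dots> = A \<otimes> B [^] int k"
    unfolding C_pow_B_pow[symmetric] by (simp add: m_assoc int_pow_mult_assoc)
  finally show ?thesis by simp
qed

text \<open>Compares the two evaluations of the commutator of \<open>A\<close> and \<open>B\<^sup>\<beta>\<close>.\<close>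

lemma key_relation:
  assumes a: "\<alpha> = int a" and b: "\<beta> = int b"
  shows "B [^] (\<beta> * (\<beta> ^ b - gsum \<beta> b)) \<otimes> C [^] int b = C [^] int a \<otimes> A [^] (gsum \<alpha> a - \<alpha> ^ a)"
proof -
  have e: "int b * \<beta> ^ b - \<beta> * gsum \<beta> b = \<beta> * (\<beta> ^ b - gsum \<beta> b)"
    using b by (simp add: algebra_simps)
  have 1: "(C \<otimes> A) [^] int a = C [^] int a \<otimes> A [^] gsum \<alpha> a" using C_A_pow[of 1 1 a] by simp
  have "B [^] int b \<otimes> (C [^] int a \<otimes> A [^] gsum \<alpha> a) = A \<otimes> B [^] int b"
    using A_pow_B_pow_beta a b 1 by simp
  then have "B [^] int b \<otimes> (C [^] int a \<otimes> A [^] gsum \<alpha> a)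
      = B [^] int b \<otimes> (A \<otimes> (B [^] (\<beta> * (\<beta> ^ b - gsum \<beta> b)) \<otimes> C [^] int b))"
    unfolding A_B_pow e .
  then have "C [^] int a \<otimes> A [^] gsum \<alpha> a = A \<otimes> (B [^] (\<beta> * (\<beta> ^ b - gsum \<beta> b)) \<otimes> C [^] int b)"
    by (rule l_cancelD[rotated 3]) simp_all
  then have "A [^] (- 1::int) \<otimes> (A [^] (1::int) \<otimes> (B [^] (\<beta> * (\<beta> ^ b - gsum \<beta> b)) \<otimes> C [^] int b))
    = A [^] (- 1 :: int) \<otimes> (C [^] int a \<otimes> A [^] gsum \<alpha> a)" by simp
  also have "\<dots> = (A [^] (- 1 :: int) \<otimes> C [^] int a) \<otimes> A [^] gsum \<alpha> a" by (simp add: m_assoc)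
  also have "\<dots> = C [^] int a \<otimes> A [^] (gsum \<alpha> a - \<alpha> ^ a)"
    unfolding A_pow_C_pow by (simp add: m_assoc flip: int_pow_mult)
  finally show ?thesis by (simp add: int_pow_mult_assoc del: int_pow_1)
qed

text \<open>Solves \<open>key_relation\<close> for the power of B. The inverse of C^b is written as
  C^((f - 1) b), which keeps the exponents of C natural numbers. The resulting D equals \<alpha> -
  \<beta> + f b, and the divisibility of f preserves the valuation of \<alpha> - \<beta>.\<close>

lemma B_pow_relation:
  assumes a: "\<alpha> = int a" and b: "\<beta> = int b" "b \<ge> 2"
    and m: "val2 m (\<alpha> - 1)" "m \<ge> 1" and n: "val2 n (\<beta> - 1)" "n \<ge> 1" and d: "val2 d (\<alpha> - \<beta>)"
    and f: "f > 0" "C [^] int f = \<one>" "2 ^ Suc d dvd int f"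
  shows "\<exists>x D y. val2 (2 * n - 1) (int x) \<and> val2 d (int D) \<and> val2 (2 * m - 1) y
    \<and> B [^] int x = C [^] int D \<otimes> A [^] y"
proof -
  define x where "x = \<beta> * (\<beta> ^ b - gsum \<beta> b)"
  define y0 where "y0 = gsum \<alpha> a - \<alpha> ^ a"
  define k where "k = (f - 1) * b"
  have ik: "int k = (int f - 1) * int b" unfolding k_def using f(1) by (simp add: of_nat_diff)
  have odd: "odd \<alpha>" "odd \<beta>" using val2_dvd[OF m] val2_dvd[OF n] by auto
  \<comment> \<open>Since \<beta> - 1 is at least 1, the sum is at most (\<beta> - 1) gsum \<beta> b
    = \<beta>^b - 1, so x is nonnegative.\<close>
  have "gsum \<beta> b \<le> (\<beta> - 1) * gsum \<beta> b"
    using b mult_right_mono[of 1 "\<beta> - 1" "gsum \<beta> b"] by (simp add: gsum_def sum_nonneg)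
  then have "x \<ge> 0" unfolding x_def using b by (simp add: gsum_pow_minus_one)
  then have x: "int (nat x) = x" by simp
  have "C [^] (int b + int k) = \<one>"
    using f int_pow_eq_one_of_dvd[OF C f(2), of "int b + int k"]
    by (simp add: ik algebra_simps)
  then have "B [^] x = (B [^] x \<otimes> C [^] int b) \<otimes> C [^] int k"
    by (simp add: m_assoc flip: int_pow_mult)
  also have "\<dots> = C [^] int a \<otimes> (A [^] y0 \<otimes> C [^] int k)"
    unfolding x_def y0_def key_relation[OF a b(1)] by (simp add: m_assoc)
  also have "\<dots> = C [^] int (a + k) \<otimes> A [^] (y0 * \<alpha> ^ k)"
    unfolding A_pow_C_pow by (simp add: int_pow_mult_assoc)
  finally have "B [^] int (nat x) = C [^] int (a + k) \<otimes> A [^] (y0 * \<alpha> ^ k)" unfolding x .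
  moreover have "val2 (2 * n - 1) (int (nat x))"
    unfolding x unfolding x_def using val2_mult_odd[OF val2_pow_minus_gsum[OF n b(1)] odd(2)]
        by (simp add: mult.commute)
  moreover have "val2 (2 * m - 1) (y0 * \<alpha> ^ k)"
    using val2_pow_odd[OF odd(1)] val2_pow_minus_gsum[OF m a] val2_neg[of _ y0]
        by (simp add: y0_def)
  moreover have "val2 d (int (a + k))"
  proof -
    have "int (a + k) = (\<alpha> - \<beta>) + int f * int b"
      using a b by (simp add: ik algebra_simps)
    then show ?thesis using val2_add[OF d, of "int f * int b"] f(3) by (simp only: dvd_mult2)
  qed
  ultimately show ?thesis by blast
qed

text \<open>
  By hypothesis \<open>R\<close> the element \<open>B\<^sup>x\<close> acts on \<open>A\<close> like \<open>C\<^sup>D\<close>; this is compared with the general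
  formula for the commutator of \<open>A\<close> and \<open>B\<^sup>x\<close>.
\<close>

lemma A_pow_eq_C_pow:
  assumes m: "val2 m (\<alpha> - 1)" "m \<ge> 2" and n: "val2 n (\<beta> - 1)" "n \<ge> 2"
    and dn: "d \<le> n" "d + 2 < m + n"
    and R: "B [^] int x
        = C [^] int D \<otimes> A [^] y" "val2 (2 * n - 1) (int x)" "val2 d (int D)" "val2 (2 * m - 1) y"
    and f: "f > 0" "C [^] int f = \<one>" and M: "odd M" "B [^] (2 ^ z * int M) = \<one>"
  shows "\<exists>s (t::int). A [^] s = C [^] t \<and> val2 (m + d) s \<and> 2 ^ (d + n - 1) dvd t"
proof -
  define e where "e = int x * \<beta> ^ x - \<beta> * gsum \<beta> x"
  define k where "k = (f - 1) * x"
  have ik: "int k = (int f - 1) * int x" unfolding k_def using f(1) by (simp add: of_nat_diff)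
  define w where "w = (\<alpha> ^ D - 1) * \<alpha> ^ k"
  have odd: "odd \<alpha>" "odd \<beta>" using val2_dvd[OF m(1), of 1] val2_dvd[OF n(1), of 1] m n by auto
  have "C [^] (int x + int k) = \<one>"
    using f int_pow_eq_one_of_dvd[OF C f(2), of "int x + int k"]
    by (simp add: ik algebra_simps)
  then have k: "C [^] int x \<otimes> C [^] int k = \<one>" by (simp add: int_pow_mult)
  have "B [^] int x \<otimes> A [^] (\<alpha> ^ D) = A \<otimes> B [^] int x"
    using intertwine_of_relation[OF A_pow_hull R(1)[symmetric]] by simp
  also have "\<dots> = B [^] int x \<otimes> (A \<otimes> (B [^] e \<otimes> C [^] int x))" unfolding e_def by (rule A_B_pow)
  finally have "A [^] (\<alpha> ^ D) = A \<otimes> (B [^] e \<otimes> C [^] int x)" by (rule l_cancelD[rotated 3]) simp_all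
  then have "A [^] (- 1::int) \<otimes> (A [^] (1::int) \<otimes> (B [^] e \<otimes> C [^] int x)) \<otimes> C [^] int k
    = A [^] (- 1::int) \<otimes> A [^] (\<alpha> ^ D) \<otimes> C [^] int k" by simp
  then have "B [^] e = A [^] (\<alpha> ^ D - 1) \<otimes> C [^] int k"
    by (simp add: int_pow_mult_assoc m_assoc k del: int_pow_1 flip: int_pow_mult)
  then have e: "B [^] e = C [^] int k \<otimes> A [^] w" unfolding A_pow_C_pow w_def .
  have d0: "2 ^ (2 * n - 1) dvd int x" using R(2) by (rule val2_dvd) simp
  \<comment> \<open>The exponent e has n - 1 factors 2 beyond the valuation of x. Hence, up to the
    odd factor M, B^e is a power of B^x, which \<open>R\<close> turns back into powers of C and A; B
    thereby disappears from the equation.\<close>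
  have "2 ^ ((2 * n - 1) + (n - 1)) dvd e"
  proof -
    have v: "val2 (n + (2 * n - 1)) (\<beta> ^ x - 1)" by (rule val2_pow_minus_one[OF n R(2)])
    have l: "(2 * n - 1) + (n - 1) \<le> n + (2 * n - 1)" by simp
    have 1: "2 ^ ((2 * n - 1) + (n - 1)) dvd \<beta> ^ x - 1" by (rule val2_dvd[OF v l])
    have "2 ^ Suc (n - 1) dvd \<beta> - 1" using val2_dvd[OF n(1), of n] n(2) by simp
    from gsum_cong_fine[OF this d0]
    have 2: "2 ^ ((2 * n - 1) + (n - 1)) dvd gsum \<beta> x - int x" .
    have "\<beta> * gsum \<beta> x = (\<beta> ^ x - 1) + gsum \<beta> x"
      using gsum_pow_minus_one[of \<beta> x] by (simp add: algebra_simps)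
    then have "e = int x * (\<beta> ^ x - 1) - (\<beta> ^ x - 1) - (gsum \<beta> x - int x)"
      unfolding e_def by (simp add: algebra_simps)
    then show ?thesis using 1 2 by (simp only: dvd_diff dvd_mult)
  qed
  from int_pow_transfer[OF B M(2) R(2) this] obtain r where
    r: "2 ^ (n - 1) dvd int r" "B [^] (e * int M) = B [^] (int x * int r)" by blast
  define u v where "u = y * gsum (\<alpha> ^ D) r" and "v = w * gsum (\<alpha> ^ k) M"
  have "C [^] (int D * int r) \<otimes> A [^] u = (B [^] int x) [^] int r" unfolding R(1) C_A_pow u_def ..
  also have "\<dots> = (B [^] e) [^] int M" using r(2) by (simp add: int_pow_pow)
  also have "\<dots> = C [^] (int k * int M) \<otimes> A [^] v" unfolding e C_A_pow v_def ..
  finally have "C [^] (- (int k * int M)) \<otimes> (C [^] (int D * int r) \<otimes> A [^] u) \<otimes> A [^] (- u)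
    = C [^] (- (int k * int M)) \<otimes> (C [^] (int k * int M) \<otimes> A [^] v) \<otimes> A [^] (- u)" by simp
  then have "C [^] (int D * int r - int k * int M) = A [^] (v - u)"
    by (simp add: m_assoc int_pow_mult_assoc flip: int_pow_mult)
  \<comment> \<open>The term v inherits the valuation of \<alpha>^D - 1, while u is divisible by
    2^((2 m - 1) + (n - 1)). The hypothesis d + 2 < m + n says exactly that u is negligible.\<close>
  moreover have "val2 (m + d) (v - u)"
  proof (rule val2_diff)
    have "val2 (m + d) w" unfolding w_def
        by (rule val2_pow_odd[OF odd(1) val2_pow_minus_one[OF m R(3)]])
    then show "val2 (m + d) v" unfolding v_def using odd_gsum[of "\<alpha> ^ k" M] odd M
        by (intro val2_mult_odd) auto
    have "2 ^ (2 * m - 1) * 2 ^ (n - 1) dvd u" unfolding u_def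
      using val2_dvd[OF R(4)] dvd_gsum[of "\<alpha> ^ D", OF _ r(1)] odd by (intro mult_dvd_mono) auto
    moreover have "Suc (m + d) \<le> (2 * m - 1) + (n - 1)" using m n dn by simp
    ultimately show "2 ^ Suc (m + d) dvd u" by (metis power_add power_le_dvd)
  qed
  moreover have "2 ^ (d + n - 1) dvd int D * int r - int k * int M"
  proof (rule dvd_diff)
    have "2 ^ d * 2 ^ (n - 1) dvd int D * int r" using val2_dvd[OF R(3)] r(1)
        by (intro mult_dvd_mono) auto
    then show "2 ^ (d + n - 1) dvd int D * int r" using n by (simp flip: power_add)
    have "d + n - 1 \<le> 2 * n - 1" using dn by simp
    then have "2 ^ (d + n - 1) dvd int x" using d0 power_le_dvd by blast
    then show "2 ^ (d + n - 1) dvd int k * int M" by (simp add: k_def)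
  qed
  ultimately show ?thesis by metis
qed

text \<open>Up to odd factors B^(2 x) is computed twice: as a power of B^s', hence of C, and as the
  square of C^D A^y. The power of A in this square has valuation 2 m > m + n, so it is a power of
  A^s = C^t. What remains is a vanishing power of C whose valuation n + 1 comes from 2 D alone. It
  also kills C^t up to an odd factor, hence A^s.\<close>

lemma two_part_bounds_pos:
  assumes a: "\<alpha> = int a" "a \<ge> 2" and b: "\<beta> = int b" "b \<ge> 2"
    and m: "val2 m (\<alpha> - 1)" and n: "val2 n (\<beta> - 1)" "n \<ge> 2" and mn: "n < m" and d: "val2 n (\<alpha> - \<beta>)"
    and tors: "torsion A" "torsion B" "torsion C"
  shows "\<exists>s c x D y. val2 (m + n) s \<and> A [^] s = \<one> \<and> val2 (n + 1) c \<and> C [^] c = \<one> \<and>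
    val2 (2 * n - 1) x \<and> B [^] x = C [^] (D::int) \<otimes> A [^] (y::int)"
proof -
  interpret S: macdonald G B A "inv C" \<beta> \<alpha> by (rule macdonald_swap)
  obtain zA MA where MA: "odd MA" "A [^] (2 ^ zA * int MA) = \<one>"
      using torsion_decompose[OF tors(1)] .
  obtain zB MB where MB: "odd MB" "B [^] (2 ^ zB * int MB) = \<one>"
      using torsion_decompose[OF tors(2)] .
  obtain zC MC where MC: "odd MC" "C [^] (2 ^ zC * int MC) = \<one>"
      using torsion_decompose[OF tors(3)] .
  define f where "f = 2 ^ (zC + Suc n) * MC"
  have f: "f > 0" "C [^] int f = \<one>" "2 ^ Suc n dvd int f"
    using MC int_pow_eq_one_of_dvd[OF C MC(2), of "int f"]
    by (auto simp: f_def power_add odd_pos intro!: mult_dvd_mono)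
  have f': "(inv C) [^] int f = \<one>" using f(2) by (simp add: int_pow_inv)
  have d': "val2 n (\<beta> - \<alpha>)" using d val2_neg[of n "\<alpha> - \<beta>"] by simp
  have m2: "m \<ge> 1" "m \<ge> 2" "m \<ge> 3" "n \<ge> 1" using mn n by auto
  obtain x D y where R: "val2 (2 * n - 1) (int x)" "val2 n (int D)" "val2 (2 * m - 1) y"
    "B [^] int x = C [^] int D \<otimes> A [^] y"
    using B_pow_relation[OF a(1) b m m2(1) n(1) m2(4) d f] by blast
  obtain x' D' y' where R': "val2 (2 * m - 1) (int x')" "val2 n (int D')" "val2 (2 * n - 1) y'"
    "A [^] int x' = (inv C) [^] int D' \<otimes> B [^] y'"
    using S.B_pow_relation[OF b(1) a n(1) m2(4) m m2(1) d' f(1) f' f(3)] by blast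
  obtain s and t :: int where st: "A [^] s = C [^] t" "val2 (m + n) s" "2 ^ (n + n - 1) dvd t"
    using A_pow_eq_C_pow[OF m m2(2) n _ _ R(4) R(1-3) f(1,2) MB] m2 by auto
  obtain s' and t' :: int where "B [^] s' = (inv C) [^] t'" and s': "val2 (n + n) s'"
      and t': "2 ^ (n + m - 1) dvd t'"
    using S.A_pow_eq_C_pow[OF n m m2(2) _ _ R'(4) R'(1-3) f(1) f' MA] m2 mn by auto
  then have st': "B [^] s' = C [^] (- t')" by (simp add: C_pow_inv)
  have odd: "4 dvd \<alpha> ^ D - 1"
  proof -
    have "4 dvd \<alpha> - 1" using val2_dvd[OF m m2(2)] by simp
    then show ?thesis using gsum_pow_minus_one[of \<alpha> D] by (metis dvd_mult2)
  qed
  \<comment> \<open>The valuation of x is one less than that of s', hence the factor 2.\<close>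
  have "2 ^ (n + n + 0) dvd 2 * int x" using val2_dvd[OF val2_double[OF R(1)], of "n + n"] n by simp
  from int_pow_transfer[OF B MB(2) s' this] obtain r where
    r: "B [^] (2 * int x * int MB) = B [^] (s' * int r)" by blast
  define w where "w = y * gsum (\<alpha> ^ D) (2 * MB)"
  define c1 where "c1 = int D * int (2 * MB)"
  have "C [^] c1 \<otimes> A [^] w = (B [^] int x) [^] int (2 * MB)"
    unfolding R(4) C_A_pow w_def c1_def ..
  also have "\<dots> = (B [^] s') [^] int r" using r by (simp add: int_pow_pow algebra_simps)
  also have "\<dots> = C [^] (- t' * int r)" unfolding st' by (simp add: int_pow_pow)
  finally have "C [^] (- c1) \<otimes> (C [^] c1 \<otimes> A [^] w) = C [^] (- c1) \<otimes> C [^] (- t' * int r)" by simp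
  then have w: "A [^] w = C [^] (- c1 - t' * int r)"
    by (simp add: int_pow_mult_assoc flip: int_pow_mult)
  have "val2 1 (int (2 * MB))" using MB(1) val2_double[of 0 "int MB"] by simp
  from val2_mult[OF R(3) val2_gsum[OF odd this]] have vw: "val2 (2 * m) w"
    using m2 by (simp add: w_def)
  \<comment> \<open>As n < m, one factor 2 is left over and makes r' even. For n = 2 this is just
    enough to make t r' negligible against c1.\<close>
  have "2 ^ (m + n + 1) dvd w" using vw by (rule val2_dvd) (use mn in simp)
  from int_pow_transfer[OF A MA(2) st(2) this] obtain r' where
    r': "2 ^ 1 dvd int r'" "A [^] (w * int MA) = A [^] (s * int r')" by blast
  define c where "c = t * int r' - (- c1 - t' * int r) * int MA"
  have "C [^] ((- c1 - t' * int r) * int MA) = C [^] (t * int r')"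
    using r'(2) w st(1) by (metis A C int_pow_pow)
  then have Cc: "C [^] c = \<one>" unfolding c_def using int_pow_diff[OF C, of "t * int r'"] by simp
  have vc: "val2 (n + 1) c"
  proof -
    have "val2 (n + 1) c1" unfolding c1_def by (rule val2_mult[OF R(2)]) fact
    then have 1: "val2 (n + 1) (c1 * int MA)" using MA(1) by (intro val2_mult_odd) auto
    have "2 ^ (n + n - 1) * 2 ^ 1 dvd t * int r'" by (rule mult_dvd_mono[OF st(3) r'(1)])
    moreover have "Suc (n + 1) \<le> n + n - 1 + 1" using n by simp
    ultimately have "2 ^ Suc (n + 1) dvd t * int r'" by (metis power_add power_le_dvd)
    moreover have "2 ^ Suc (n + 1) dvd t'" using t' by (rule power_le_dvd) (use m2 in simp)
    ultimately have 2: "2 ^ Suc (n + 1) dvd t * int r' + t' * int r * int MA"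
        by (rule dvd_add[OF _ dvd_mult2[OF dvd_mult2]])
    have "c = c1 * int MA + (t * int r' + t' * int r * int MA)" by (simp add: c_def algebra_simps)
    then show ?thesis using val2_add[OF 1 2] by simp
  qed
  have "n + 1 + 0 \<le> n + n - 1" using n by simp
  then have "2 ^ (n + 1 + 0) dvd t" using st(3) power_le_dvd by blast
  from int_pow_transfer[OF C MC(2) vc this] obtain r'' where
    r'': "C [^] (t * int MC) = C [^] (c * int r'')" by blast
  have "A [^] (s * int MC) = C [^] (t * int MC)" using st(1) by (metis A C int_pow_pow)
  also have "\<dots> = \<one>" unfolding r'' using int_pow_eq_one_of_dvd[OF C Cc] by simp
  finally have "A [^] (s * int MC) = \<one>" .
  moreover have "val2 (m + n) (s * int MC)" using st(2) MC(1) by (intro val2_mult_odd) auto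
  ultimately show ?thesis using vc Cc R(1,4) by blast
qed

end

section \<open>The two-part of the group order\<close>

context group
begin

lemma int_pow_cong:
  assumes "g \<in> carrier G" "g [^] (e::int) = \<one>" "e dvd i - j"
  shows "g [^] i = g [^] j"
proof -
  have "g [^] (i - j) = \<one>" by (rule int_pow_eq_one_of_dvd[OF assms])
  then have "g [^] ((i - j) + j) = \<one> \<otimes> g [^] j" using assms(1) by (simp only: int_pow_mult)
  then show ?thesis using assms(1) by simp
qed

lemma torsion_int_pow_nat:
  assumes "g \<in> carrier G" "torsion g"
  obtains k :: nat where "g [^] (i::int) = g [^] int k"
proof -
  obtain e where e: "e > 0" "g [^] int e = \<one>" using assms by (auto simp: torsion_def)
  then have "g [^] i = g [^] int (nat (i mod int e))"
    by (intro int_pow_cong[OF assms(1) e(2)]) (simp add: minus_mod_eq_mult_div)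
  then show ?thesis by (rule that)
qed

text \<open>L is counted as a union of cosets of K and need not be a subgroup. The least positive x0
  with b^x0 in K is the number of distinct cosets K b^i, and it divides every exponent that brings b
  into K.\<close>

lemma card_subgroup_mult_powers:
  assumes K: "subgroup K G" "finite K" and b: "b \<in> carrier G" and x: "x \<noteq> 0" "b [^] (x::int) \<in> K"
  defines "L \<equiv> {k \<otimes> b [^] (i::int) | k i. k \<in> K}"
  shows "finite L \<and> (\<exists>x0. int x0 dvd x \<and> card L = card K * x0)"
proof -
  interpret K: subgroup K G by fact
  define P where "P j \<longleftrightarrow> j > 0 \<and> b [^] int j \<in> K" for j
  define x0 where "x0 = (LEAST j. P j)"
  have "b [^] (- x) \<in> K" using K.m_inv_closed[OF x(2)] b by (simp add: int_pow_neg)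
  then have "P (nat \<bar>x\<bar>)" using x by (auto simp: P_def abs_if)
  then have P: "P x0" unfolding x0_def by (rule LeastI)
  have x0: "x0 > 0" "b [^] int x0 \<in> K" using P by (auto simp: P_def)
  have dvd: "int x0 dvd i" if i: "b [^] i \<in> K" for i
  proof -
    have pw: "b [^] (int x0 * l) \<in> K" for l
      using subgroup_int_pow_closed[OF K(1) x0(2), of l] b by (simp add: int_pow_pow)
    have "b [^] (i mod int x0) = b [^] i \<otimes> b [^] (int x0 * (- (i div int x0)))"
      using b by (simp add: minus_mult_div_eq_mod flip: int_pow_mult)
    then have "b [^] (i mod int x0) \<in> K" using i pw by (simp only: K.m_closed)
    then have "P (nat (i mod int x0))" if "nat (i mod int x0) \<noteq> 0" using that by (auto simp: P_def)
    then have "\<not> nat (i mod int x0) < x0 \<or> nat (i mod int x0) = 0"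
      using not_less_Least[of "nat (i mod int x0)" P] unfolding x0_def[symmetric] by blast
    moreover have "nat (i mod int x0) < x0" "i mod int x0 \<ge> 0" using x0(1)
        by (simp_all add: nat_less_iff)
    ultimately have "i mod int x0 = 0" by simp
    then show ?thesis by (simp add: dvd_eq_mod_eq_0)
  qed
  define h where "h = (\<lambda>(k, i). k \<otimes> b [^] int i)"
  have inj: "inj_on h (K \<times> {..<x0})"
  proof (rule inj_onI)
    fix p q
    assume pq: "p \<in> K \<times> {..<x0}" "q \<in> K \<times> {..<x0}" "h p = h q"
    obtain k i k' i' where ki: "p = (k, i)" "q = (k', i')" by (cases p, cases q)
    have k: "k \<in> K" "k' \<in> K" and i: "i < x0" "i' < x0"
      and eq: "k \<otimes> b [^] int i = k' \<otimes> b [^] int i'"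
      using pq by (auto simp: ki h_def)
    have "inv k' \<otimes> (k \<otimes> b [^] int i) \<otimes> b [^] (- int i) = inv k' \<otimes> k"
      using k b by (simp add: m_assoc flip: int_pow_mult)
    moreover have "inv k' \<otimes> (k' \<otimes> b [^] int i') \<otimes> b [^] (- int i) = b [^] (int i' - int i)"
      using k b by (simp flip: m_assoc int_pow_mult)
    ultimately have 1: "inv k' \<otimes> k = b [^] (int i' - int i)" using eq by simp
    then have "b [^] (int i' - int i) \<in> K" using k by (metis K.m_closed K.m_inv_closed)
    from dvd[OF this] have "int i' mod int x0 = int i mod int x0" by (simp add: mod_eq_dvd_iff)
    then have "i' = i" using i by simp
    then have "inv k' \<otimes> k = \<one>" using 1 by simp
    then have "k = k'" using k by (metis K.mem_carrier inv_closed inv_equality inv_inv)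
    then show "p = q" unfolding ki using \<open>i' = i\<close> by simp
  qed
  have "h ` (K \<times> {..<x0}) = L"
  proof (intro equalityI subsetI)
    fix g assume "g \<in> L"
    then obtain k i where g: "g = k \<otimes> b [^] (i::int)" "k \<in> K" by (auto simp: L_def)
    have "b [^] (int x0 * (i div int x0)) \<in> K"
      using subgroup_int_pow_closed[OF K(1) x0(2), of "i div int x0"] b by (simp add: int_pow_pow)
    moreover have "g = (k \<otimes> b [^] (int x0 * (i div int x0))) \<otimes> b [^] int (nat (i mod int x0))"
      using g b x0(1) by (simp add: m_assoc flip: int_pow_mult)
    ultimately show "g \<in> h ` (K \<times> {..<x0})"
      using g(2) x0(1)
          by (intro image_eqI[of _ _ "(k \<otimes> b [^] (int x0 * (i div int x0)), nat (i mod int x0))"])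
        (auto simp: h_def nat_less_iff)
  next
    fix g assume "g \<in> h ` (K \<times> {..<x0})"
    then obtain k i where "g = k \<otimes> b [^] int i" "k \<in> K" by (auto simp: h_def)
    then show "g \<in> L" unfolding L_def by blast
  qed
  then have "finite L" "card L = card K * x0"
    using card_image[OF inj] K(2) by (auto simp: card_cartesian_product)
  then show ?thesis using dvd[OF x(2)] by blast
qed

end

context macdonald
begin

lemma macdonald_cong:
  assumes "A [^] (e::int) = \<one>" "e dvd \<alpha>' - \<alpha>" "B [^] (e'::int) = \<one>" "e' dvd \<beta>' - \<beta>"
  shows "macdonald G A B C \<alpha>' \<beta>'"
  using int_pow_cong[OF A assms(1,2)] int_pow_cong[OF B assms(3,4)] AC CB AB
  by unfold_locales auto

lemma two_part_bounds:
  assumes m: "val2 m (\<alpha> - 1)" and n: "val2 n (\<beta> - 1)" "n \<ge> 2" and mn: "n < m"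
      and d: "val2 n (\<alpha> - \<beta>)"
  shows "torsion A" "torsion B" "torsion C"
    "\<exists>s c x D y. val2 (m + n) s \<and> A [^] s = \<one> \<and> val2 (n + 1) c \<and> C [^] c = \<one> \<and>
    val2 (2 * n - 1) x \<and> B [^] x = C [^] (D::int) \<otimes> A [^] (y::int)"
proof -
  have "4 dvd \<alpha> - 1" "4 dvd \<beta> - 1" using val2_dvd[OF m, of 2] val2_dvd[OF n] mn n by auto
  moreover have "\<alpha> - 1 \<noteq> 0" "\<beta> - 1 \<noteq> 0" "\<alpha> \<noteq> \<beta>"
      using val2_nonzero[OF m] val2_nonzero[OF n(1)] val2_nonzero[OF d] by auto
  ultimately have "\<bar>\<alpha>\<bar> \<ge> 2" "\<bar>\<beta>\<bar> \<ge> 2" "\<alpha> \<noteq> \<beta>" by presburger+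
  then show tors: "torsion A" "torsion B" "torsion C" using all_torsion by auto
  obtain ea where ea: "ea > 0" "A [^] int ea = \<one>" using tors by (auto simp: torsion_def)
  obtain eb where eb: "eb > 0" "B [^] int eb = \<one>" using tors by (auto simp: torsion_def)
  txt \<open>Only the residues of \<open>\<alpha>\<close> and \<open>\<beta>\<close> matter now, so both may be assumed to be positive.\<close>
  define E where "E = int ea * int eb * 2 ^ Suc m"
  \<comment> \<open>The orders contained in E leave the relations intact, its factor 2^(m + 1)
    preserves the three valuations, and the factors \<bar>\<alpha>\<bar> + 2 and \<bar>\<beta>\<bar>
    + 2 make the results at least 2.\<close>
  define a b where "a = nat (\<alpha> + E * (\<bar>\<alpha>\<bar> + 2))" and "b = nat (\<beta> + E * (\<bar>\<beta>\<bar> + 2))"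
  have E: "E \<ge> 1" using ea eb
      by (simp add: E_def Suc_leI) (metis int_one_le_iff_zero_less mult_pos_pos of_nat_0_less_iff zero_less_power zero_less_numeral)
  have ge: "q + E * (\<bar>q\<bar> + 2) \<ge> 2" for q :: int
    using mult_right_mono[OF E, of "\<bar>q\<bar> + 2"] by simp
  have ab: "int a = \<alpha> + E * (\<bar>\<alpha>\<bar> + 2)" "int b = \<beta> + E * (\<bar>\<beta>\<bar> + 2)"
    using ge[of \<alpha>] ge[of \<beta>] by (auto simp: a_def b_def)
  have ab2: "a \<ge> 2" "b \<ge> 2" using ge[of \<alpha>] ge[of \<beta>] ab by linarith+
  have "macdonald G A B C (int a) (int b)"
    by (rule macdonald_cong[OF ea(2) _ eb(2)]) (auto simp: ab E_def)
  then interpret P: macdonald G A B C "int a" "int b" .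
  have Em: "2 ^ Suc m dvd E" "2 ^ Suc n dvd E"
    unfolding E_def using mn by (simp_all add: le_imp_power_dvd del: power_Suc)
  have v: "val2 m (int a - 1)" "val2 n (int b - 1)" "val2 n (int a - int b)"
    using val2_add[OF m dvd_mult2[OF Em(1)], of "\<bar>\<alpha>\<bar> + 2"]
      val2_add[OF n(1) dvd_mult2[OF Em(2)], of "\<bar>\<beta>\<bar> + 2"]
      val2_add[OF d dvd_mult2[OF Em(2)], of "\<bar>\<alpha>\<bar> - \<bar>\<beta>\<bar>"]
    unfolding ab by (simp_all add: algebra_simps)
  show "\<exists>s c x D y. val2 (m + n) s \<and> A [^] s = \<one> \<and> val2 (n + 1) c \<and> C [^] c = \<one> \<and>
    val2 (2 * n - 1) x \<and> B [^] x = C [^] (D::int) \<otimes> A [^] (y::int)"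
    using P.two_part_bounds_pos[OF refl ab2(1) refl ab2(2) v(1,2) n(2) mn v(3) tors] .
qed

section \<open>Normal form of the elements and the order bound\<close>

definition CA_powers where
  "CA_powers = {C [^] (j::int) \<otimes> A [^] (i::int) | j i. True}"

lemma CA_powersI: "C [^] (j::int) \<otimes> A [^] (i::int) \<in> CA_powers"
  unfolding CA_powers_def by blast

text \<open>\<open>A_pow_C_pow\<close> moves only nonnegative powers of C past A; finite order of C
  reduces the other powers to these.\<close>

lemma subgroup_C_A:
  assumes "torsion C"
  shows "subgroup CA_powers G"
proof (rule subgroupI)
  show "CA_powers \<subseteq> carrier G" by (auto simp: CA_powers_def)
  show "CA_powers \<noteq> {}" by (auto simp: CA_powers_def)
  have AC': "A [^] i \<otimes> C [^] j \<in> CA_powers" for i j :: int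
  proof -
    obtain k where "C [^] j = C [^] int k" using torsion_int_pow_nat[OF C assms] .
    then show ?thesis using A_pow_C_pow[of i k] by (simp add: CA_powersI del: pow_nat)
  qed
  fix g assume "g \<in> CA_powers"
  then obtain j i where g: "g = C [^] (j::int) \<otimes> A [^] (i::int)" by (auto simp: CA_powers_def)
  have "inv g = A [^] (- i) \<otimes> C [^] (- j)" unfolding g by (simp add: inv_mult_group int_pow_neg)
  then show "inv g \<in> CA_powers" using AC' by simp
  fix h assume "h \<in> CA_powers"
  then obtain j' i' where h: "h = C [^] (j'::int) \<otimes> A [^] (i'::int)" by (auto simp: CA_powers_def)
  obtain p q where pq: "A [^] i \<otimes> C [^] j' = C [^] (p::int) \<otimes> A [^] (q::int)" using AC'[of i j']
      unfolding CA_powers_def by blast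
  have "g \<otimes> h = C [^] j \<otimes> (A [^] i \<otimes> C [^] j') \<otimes> A [^] i'" unfolding g h by (simp add: m_assoc)
  also have "\<dots> = C [^] (j + p) \<otimes> A [^] (q + i')" unfolding pq
      by (simp add: m_assoc int_pow_mult_assoc flip: int_pow_mult)
  finally show "g \<otimes> h \<in> CA_powers" by (simp add: CA_powersI)
qed

text \<open>The set of normal forms contains the identity and is closed under right multiplication
  by the generators and their inverses. Finite order turns the exponents of B into natural numbers
  and the inverse of A into a positive power.\<close>

lemma carrier_normal_form:
  assumes gen: "generate G {A, B} = carrier G" and tors: "torsion A" "torsion B" "torsion C"
  shows "carrier G = {g \<otimes> B [^] (k::int) | g k. g \<in> CA_powers}"
proof -
  interpret K: subgroup CA_powers G
    by (rule subgroup_C_A[OF tors(3)])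
  define N where "N = {g \<otimes> B [^] (k::int) | g k. g \<in> CA_powers}"
  have NI: "g \<otimes> B [^] (k::int) \<in> N" if "g \<in> CA_powers" for g k using that unfolding N_def by blast
  have NE: "\<exists>k' l. k' \<in> CA_powers \<and> g = k' \<otimes> B [^] (l::int)" if "g \<in> N" for g
    using that unfolding N_def by blast
  have Nc: "N \<subseteq> carrier G" unfolding N_def by auto
  have NA: "g \<otimes> A \<in> N" if gN: "g \<in> N" for g
  proof -
    obtain k' l where k': "k' \<in> CA_powers" "g = k' \<otimes> B [^] (l::int)" using NE[OF gN] by blast
    obtain k where k: "B [^] l = B [^] int k" using torsion_int_pow_nat[OF B tors(2)] .
    have kc: "k' \<in> carrier G" using k'(1) by auto
    have 1: "A \<in> CA_powers" "C [^] (- int k) \<in> CA_powers"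
      using CA_powersI[of 0 1] CA_powersI[of "- int k" 0] by simp_all
    have "g \<otimes> A = k' \<otimes> (B [^] int k \<otimes> A)" unfolding k'(2) k using kc by (simp add: m_assoc)
    also have "\<dots> = (k' \<otimes> (A \<otimes> C [^] (- int k))) \<otimes> B [^] (\<beta> * gsum \<beta> k)"
      unfolding B_pow_A_normal using kc by (simp add: m_assoc)
    finally show ?thesis using NI[OF K.m_closed[OF k'(1) K.m_closed[OF 1]]] by simp
  qed
  have NA': "g \<otimes> A [^] k \<in> N" if "g \<in> N" for g and k :: nat
  proof (induction k)
    case (Suc k)
    have "g \<in> carrier G" using that Nc by auto
    then have "g \<otimes> A [^] Suc k = (g \<otimes> A [^] k) \<otimes> A" by (simp add: m_assoc)
    then show ?case using NA[OF Suc] by simp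
  next
    case 0
    have "g \<in> carrier G" using that Nc by auto
    then show ?case using that by simp
  qed
  have NB: "g \<otimes> B [^] i \<in> N" if gN: "g \<in> N" for g and i :: int
  proof -
    obtain k' l where k': "k' \<in> CA_powers" "g = k' \<otimes> B [^] (l::int)" using NE[OF gN] by blast
    then have "g \<otimes> B [^] i = k' \<otimes> B [^] (l + i)" by (auto simp: m_assoc int_pow_mult)
    then show ?thesis using NI[OF k'(1)] by simp
  qed
  have "\<forall>g \<in> N. g \<otimes> h \<in> N" if "h \<in> generate G {A, B}" for h
    using that
  proof (induction rule: generate.induct)
    case one
    then show ?case using Nc by auto
  next
    case (incl h)
    then show ?case using NA NB[of _ 1] by auto
  next
    case (inv h)
    obtain k where "A [^] (- 1 :: int) = A [^] int k" using torsion_int_pow_nat[OF A tors(1)] .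
    then have "inv A = A [^] k" by (simp add: int_pow_neg int_pow_int)
    moreover have "inv B = B [^] (- 1 :: int)" by (simp add: int_pow_neg)
    ultimately show ?case using inv NA'[of _ k] NB[of _ "- 1"] by auto
  next
    case (eng h1 h2)
    have c: "h1 \<in> carrier G" "h2 \<in> carrier G" using eng(1,2) gen by auto
    show ?case
    proof
      fix g assume g: "g \<in> N"
      then have "g \<in> carrier G" using Nc by auto
      then have "g \<otimes> (h1 \<otimes> h2) = (g \<otimes> h1) \<otimes> h2" using c by (simp add: m_assoc)
      then show "g \<otimes> (h1 \<otimes> h2) \<in> N" using eng(3,4) g by simp
    qed
  qed
  moreover have "\<one> \<in> N" using NI[OF CA_powersI[of 0 0], of 0] by simp
  ultimately have "carrier G \<subseteq> N" unfolding gen by (metis (no_types, lifting) l_one subsetI)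
  with Nc show ?thesis unfolding N_def by simp
qed

text \<open>Counting along {1}, <C>, \<open>CA_powers\<close> and the whole group: each is the
  preceding subgroup times the powers of one further generator, and the exponents c, s and x bound
  the three steps.\<close>

theorem order_dvd:
  assumes gen: "generate G {A, B} = carrier G"
    and m: "val2 m (\<alpha> - 1)" and n: "val2 n (\<beta> - 1)" "n \<ge> 2" and mn: "n < m" and d: "val2 n (\<alpha> - \<beta>)"
  shows "finite (carrier G)" "\<exists>N. val2 (m + 4 * n) N \<and> int (order G) dvd N"
proof -
  note tors = two_part_bounds(1-3)[OF m n mn d]
  obtain s c x D y where sx: "val2 (m + n) s" "A [^] s = \<one>" "val2 (n + 1) c" "C [^] c = \<one>"
    "val2 (2 * n - 1) x" "B [^] x = C [^] (D::int) \<otimes> A [^] (y::int)"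
    using two_part_bounds(4)[OF m n mn d] by blast
  have K: "subgroup CA_powers G" by (rule subgroup_C_A[OF tors(3)])
  define L where "L = {k \<otimes> C [^] (j::int) | k j. k \<in> {\<one>}}"
  have "L = generate G {C}" unfolding generate_pow[OF C] L_def by auto
  then have sL: "subgroup L G" using generate_is_subgroup[of "{C}"] by simp
  have triv: "subgroup {\<one>} G" by (rule triv_subgroup)
  have nz: "c \<noteq> 0" "s \<noteq> 0" "x \<noteq> 0" using sx val2_nonzero by auto
  obtain c0 where c0: "finite L" "int c0 dvd c" "card L = c0"
    using card_subgroup_mult_powers[OF triv _ C nz(1)] sx(4) unfolding L_def[symmetric] by auto
  have KL: "CA_powers = {k \<otimes> A [^] (i::int) | k i. k \<in> L}" unfolding CA_powers_def L_def by auto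
  obtain s0 where s0: "finite CA_powers" "int s0 dvd s" "card CA_powers = c0 * s0"
    using card_subgroup_mult_powers[OF sL c0(1) A nz(2)] sx(2) c0(3) subgroup.one_closed[OF sL]
        unfolding KL[symmetric] by auto
  have "B [^] x \<in> CA_powers" unfolding sx(6) by (rule CA_powersI)
  from card_subgroup_mult_powers[OF K s0(1) B nz(3) this] obtain x0 where
    x0: "finite (carrier G)" "int x0 dvd x" "card (carrier G) = c0 * s0 * x0"
    unfolding carrier_normal_form[OF gen tors, symmetric] s0(3) by auto
  show "finite (carrier G)" by fact
  have "int (order G) dvd c * s * x"
    unfolding order_def x0(3) using c0 s0 x0 by (simp add: mult_dvd_mono)
  moreover have "val2 (m + 4 * n) (c * s * x)"
  proof -
    have "(n + 1) + (m + n) + (2 * n - 1) = m + 4 * n" using n by simp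
    then show ?thesis using val2_mult[OF val2_mult[OF sx(3,1)] sx(5)] by metis
  qed
  ultimately show "\<exists>N. val2 (m + 4 * n) N \<and> int (order G) dvd N" by blast
qed

end

section \<open>A model of order $2^{m+4n}$\<close>

text \<open>
  The triple \<open>(i, k, j)\<close> stands for \<open>a\<^sup>i c\<^sup>j b\<^sup>k\<close>. For \<open>p = 2^(n - 1)\<close> and \<open>h = 2^(m - n - 1)\<close> the
  parameters are \<open>\<alpha> = 1 + 4 p h u\<close> and \<open>\<beta> = 1 + 2 p v\<close>; the product is obtained by collecting in a
  group of class three in which \<open>[c, a] = a^(1 - \<alpha>)\<close>
      and \<open>[c, b] = b^(\<beta> - 1)\<close> are central. The second
  component of \<open>red\<close> accounts for the relation \<open>c^(2 p) = b^(2 p\<^sup>2)\<close>.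
\<close>

type_synonym triple = "int \<times> int \<times> int"

locale macdonald_model =
  fixes p h u v :: int
  assumes p: "p > 0" "even p" and h: "h > 0" and u: "odd u" and v: "odd v"
begin

definition red :: "triple \<Rightarrow> triple" where
  "red = (\<lambda>(i, k, j). (i mod (8 * p^2 * h), (k + p * j) mod (4 * p^2) - p * (j mod (2 * p)), j mod (2 * p)))"

definition rel :: "triple \<Rightarrow> triple \<Rightarrow> bool" where
  "rel = (\<lambda>(i, k, j) (i', k', j'). 8 * p^2 * h dvd i' - i \<and> 4 * p^2 dvd (k' - k) + p * (j' - j)
      \<and> 2 * p dvd j' - j)"

text \<open>The corrections are (\<alpha> - 1) (j i' - k binom(i', 2)) and (\<beta> - 1) (i' binom(k
  + 1, 2) - k j'). The binomials are kept doubled, so half of \<alpha> - 1 = 4 p h u and of \<beta>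
  - 1 = 2 p v appears in front.\<close>

definition prd :: "triple \<Rightarrow> triple \<Rightarrow> triple" where
  "prd = (\<lambda>(i, k, j) (i', k', j').
     (i + i' - 2 * p * h * u * (2 * j * i' - k * (i' * (i' - 1))),
      k + k' + p * v * (i' * (k * (k + 1)) - 2 * k * j'),
      j + j' - k * i'))"

definition H :: "triple monoid" where
  "H = \<lparr>carrier = range red, monoid.mult = (\<lambda>x y. red (prd x y)), one = (0, 0, 0)\<rparr>"

lemma rel_iff_red: "rel x y \<longleftrightarrow> red x = red y"
proof -
  obtain i k j i' k' j' where xy: "x = (i, k, j)" "y = (i', k', j')" by (cases x, cases y)
  have e: "(k' - k) + p * (j' - j) = (k' + p * j') - (k + p * j)" by (simp add: algebra_simps)
  have "rel x y \<longleftrightarrow> i' mod (8 * p^2 * h) = i mod (8 * p^2 * h) \<and>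
      (k' + p * j') mod (4 * p^2) = (k + p * j) mod (4 * p^2) \<and> j' mod (2 * p) = j mod (2 * p)"
    unfolding xy rel_def prod.case e by (simp add: mod_eq_dvd_iff)
  then show ?thesis unfolding xy red_def by auto
qed

lemma red_red [simp]: "red (red x) = red x"
  by (cases x) (auto simp: red_def)

lemma rel_red: "rel x (red x)"
  by (simp add: rel_iff_red)

lemma relE:
  assumes "rel (i, k, j) y"
  obtains a b c where "y = (i + 8 * p^2 * h * a, k + 2 * p^2 * (2 * b - c), j + 2 * p * c)"
proof -
  obtain i' k' j' where y: "y = (i', k', j')" by (cases y)
  obtain a where a: "i' - i = 8 * p^2 * h * a" using assms by (auto simp: rel_def y)
  obtain b where b: "(k' - k) + p * (j' - j) = 4 * p^2 * b" using assms by (auto simp: rel_def y)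
  obtain c where c: "j' - j = 2 * p * c" using assms by (auto simp: rel_def y)
  have "k' = k + 2 * p^2 * (2 * b - c)" using b unfolding c
      by (simp add: algebra_simps power2_eq_square)
  then show ?thesis using that[of a b c] a c y by (simp add: algebra_simps)
qed

lemma relI:
  assumes "i' - i = 8 * p^2 * h * a" "(k' - k) + p * (j' - j) = 4 * p^2 * b" "j' - j = 2 * p * c"
  shows "rel (i, k, j) (i', k', j')"
  unfolding rel_def using assms by simp

lemma even_pronic: obtains t :: int where "i * (i - 1) = 2 * t"
  by (metis dvd_def even_mult_iff odd_add odd_one diff_add_cancel)

lemma even_pronic': obtains t :: int where "k * (k + 1) = 2 * t"
  by (metis dvd_def even_mult_iff odd_add odd_one)

lemma prd_cong_left:
  assumes "rel x x'"
  shows "rel (prd x y) (prd x' y)"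
proof -
  obtain i k j where x: "x = (i, k, j)" by (cases x)
  obtain i2 k2 j2 where y: "y = (i2, k2, j2)" by (cases y)
  obtain a b c where x': "x' = (i + 8 * p^2 * h * a, k + 2 * p^2 * (2 * b - c), j + 2 * p * c)"
    using relE[OF assms[unfolded x]] .
  \<comment> \<open>Changing k by 2 p^2 e changes p times the third component by a multiple of 2
    p^3; it vanishes modulo 4 p^2 since p is even.\<close>
  obtain p1 where p1: "p = 2 * p1" using p by (elim evenE)
  obtain t where t: "i2 * (i2 - 1) = 2 * t" by (rule even_pronic)
  define e where "e = 2 * b - c"
  show ?thesis unfolding x x' y prd_def prod.case t
  proof (rule relI)
    show "i + 8 * p\<^sup>2 * h * a + i2 - 2 * p * h * u * (2 * (j + 2 * p * c) * i2 - (k + 2 * p\<^sup>2 * (2 * b - c)) * (2 * t)) -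
      (i + i2 - 2 * p * h * u * (2 * j * i2 - k * (2 * t))) = 8 * p\<^sup>2 * h * (a - u * c * i2 + u * p * e * t)"
      by (simp add: e_def algebra_simps power2_eq_square)
    show "j + 2 * p * c + j2 - (k + 2 * p\<^sup>2 * (2 * b - c)) * i2 - (j + j2 - k * i2)
        = 2 * p * (c - p * e * i2)"
      by (simp add: e_def algebra_simps power2_eq_square)
    show "k + 2 * p\<^sup>2 * (2 * b - c) + k2 + p * v * (i2 * ((k + 2 * p\<^sup>2 * (2 * b - c)) * (k + 2 * p\<^sup>2 * (2 * b - c) + 1)) -
        2 * (k + 2 * p\<^sup>2 * (2 * b - c)) * j2) - (k + k2 + p * v * (i2 * (k * (k + 1)) - 2 * k * j2)) +
      p * (j + 2 * p * c + j2 - (k + 2 * p\<^sup>2 * (2 * b - c)) * i2 - (j + j2 - k * i2))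
      = 4 * p\<^sup>2 * (b + p1 * v * e * (i2 * (2 * k + 1 + 2 * p^2 * e) - 2 * j2) - p1 * e * i2)"
      by (simp add: p1 e_def algebra_simps power2_eq_square)
  qed
qed

lemma prd_cong_right:
  assumes "rel y y'"
  shows "rel (prd x y) (prd x y')"
proof -
  obtain i k j where x: "x = (i, k, j)" by (cases x)
  obtain i2 k2 j2 where y: "y = (i2, k2, j2)" by (cases y)
  obtain a b c where y': "y' = (i2 + 8 * p^2 * h * a, k2 + 2 * p^2 * (2 * b - c), j2 + 2 * p * c)"
    using relE[OF assms[unfolded y]] .
  define e where "e = 2 * b - c"
  define A where "A = 8 * p^2 * h * a"
  show ?thesis unfolding x y' y prd_def prod.case A_def[symmetric]
  proof (rule relI)
    show "i + (i2 + A) - 2 * p * h * u * (2 * j * (i2 + A) - k * ((i2 + A) * (i2 + A - 1))) -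
      (i + i2 - 2 * p * h * u * (2 * j * i2 - k * (i2 * (i2 - 1))))
      = 8 * p\<^sup>2 * h * (a * (1 - 2 * p * h * u * (2 * j - k * (2 * i2 + A - 1))))"
      by (simp add: A_def algebra_simps power2_eq_square)
    show "j + (j2 + 2 * p * c) - k * (i2 + A) - (j + j2 - k * i2) = 2 * p * (c - k * 4 * p * h * a)"
      by (simp add: A_def algebra_simps power2_eq_square)
    show "k + (k2 + 2 * p\<^sup>2 * (2 * b - c)) + p * v * ((i2 + A) * (k * (k + 1)) - 2 * k * (j2 + 2 * p * c)) -
      (k + k2 + p * v * (i2 * (k * (k + 1)) - 2 * k * j2)) + p * (j + (j2 + 2 * p * c) - k * (i2 + A) - (j + j2 - k * i2))
      = 4 * p\<^sup>2 * (b + v * (2 * p * h * a * (k * (k + 1)) - k * c) - 2 * p * h * k * a)"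
      by (simp add: A_def algebra_simps power2_eq_square)
  qed
qed

lemma red_prd_red_left [simp]: "red (prd (red x) y) = red (prd x y)"
  using prd_cong_left[OF rel_red] rel_iff_red by metis

lemma red_prd_red_right [simp]: "red (prd x (red y)) = red (prd x y)"
  using prd_cong_right[OF rel_red] rel_iff_red by metis

lemma prd_assoc: "rel (prd x (prd y z)) (prd (prd x y) z)"
proof -
  obtain i k j where x: "x = (i, k, j)" by (cases x)
  obtain i2 k2 j2 where y: "y = (i2, k2, j2)" by (cases y)
  obtain i3 k3 j3 where z: "z = (i3, k3, j3)" by (cases z)
  obtain s where s: "k * (k + 1) = 2 * s" by (rule even_pronic')
  obtain t where t: "i3 * (i3 - 1) = 2 * t" by (rule even_pronic)
  \<comment> \<open>In the second component a term 2 p^2 v^2 r i3 remains. Together with -2 p^2 v r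
    i3, from p times the third component, it becomes 2 p^2 v (v - 1) r i3, and v - 1 is
    even.\<close>
  obtain v1 where v1: "v = 2 * v1 + 1" using v by (elim oddE)
  define q r where "q = j2 * i3 - k2 * t" and "r = i2 * s - k * j2"
  have q: "2 * j2 * i3 - k2 * (i3 * (i3 - 1)) = 2 * q" unfolding t q_def
      by (simp add: algebra_simps)
  have r: "i2 * (k * (k + 1)) - 2 * k * j2 = 2 * r" unfolding s r_def by (simp add: algebra_simps)
  define D E where "D = 2 * p * h * u" and "E = p * v"
  have 1: "prd x (prd y z)
      = (i + (i2 + i3 - D * (2 * q)) - D * (2 * j * (i2 + i3 - D * (2 * q)) - k * ((i2 + i3 - D * (2 * q)) * (i2 + i3 - D * (2 * q) - 1))),
      k + (k2 + k3 + E * (i3 * (k2 * (k2 + 1)) - 2 * k2 * j3)) + E * ((i2 + i3 - D * (2 * q)) * (k * (k + 1)) - 2 * k * (j2 + j3 - k2 * i3)),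
      j + (j2 + j3 - k2 * i3) - k * (i2 + i3 - D * (2 * q)))"
    unfolding x y z prd_def prod.case D_def[symmetric] E_def[symmetric] q ..
  have 2: "prd (prd x y) z
      = (i + i2 - D * (2 * j * i2 - k * (i2 * (i2 - 1))) + i3 - D * (2 * (j + j2 - k * i2) * i3 - (k + k2 + E * (2 * r)) * (i3 * (i3 - 1))),
      k + k2 + E * (2 * r) + k3 + E * (i3 * ((k + k2 + E * (2 * r)) * (k + k2 + E * (2 * r) + 1)) - 2 * (k + k2 + E * (2 * r)) * j3),
      j + j2 - k * i2 + j3 - (k + k2 + E * (2 * r)) * i3)"
    unfolding x y z prd_def prod.case D_def[symmetric] E_def[symmetric] r ..
  have I: "i + i2 - D * (2 * j * i2 - k * (i2 * (i2 - 1))) + i3 - D * (2 * (j + j2 - k * i2) * i3 - (k + k2 + E * (2 * r)) * (i3 * (i3 - 1)))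
      - (i + (i2 + i3 - D * (2 * q)) - D * (2 * j * (i2 + i3 - D * (2 * q)) - k * ((i2 + i3 - D * (2 * q)) * (i2 + i3 - D * (2 * q) - 1))))
      = D * (E * (2 * r) * (i3 * (i3 - 1)) + D * (2 * q) * (k * (2 * (i2 + i3) - 1) - 2 * j - k * D * (2 * q)))"
    unfolding q[symmetric] by (simp add: algebra_simps)
  have J: "j + j2 - k * i2 + j3 - (k + k2 + E * (2 * r)) * i3 - (j + (j2 + j3 - k2 * i3) - k * (i2 + i3 - D * (2 * q)))
      = - (E * (2 * r) * i3 + k * D * (2 * q))"
    by (simp add: algebra_simps)
  have K: "k + k2 + E * (2 * r) + k3 + E * (i3 * ((k + k2 + E * (2 * r)) * (k + k2 + E * (2 * r) + 1)) - 2 * (k + k2 + E * (2 * r)) * j3)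
      - (k + (k2 + k3 + E * (i3 * (k2 * (k2 + 1)) - 2 * k2 * j3)) + E * ((i2 + i3 - D * (2 * q)) * (k * (k + 1)) - 2 * k * (j2 + j3 - k2 * i3)))
      = E * (E * (2 * r) * (i3 * (2 * (k + k2) + 1 + E * (2 * r)) - 2 * j3) + D * (2 * q) * (k * (k + 1)))"
    unfolding r[symmetric] by (simp add: algebra_simps)
  show ?thesis unfolding 1 2
  proof (rule relI)
    show "i + i2 - D * (2 * j * i2 - k * (i2 * (i2 - 1))) + i3 - D * (2 * (j + j2 - k * i2) * i3 - (k + k2 + E * (2 * r)) * (i3 * (i3 - 1)))
      - (i + (i2 + i3 - D * (2 * q)) - D * (2 * j * (i2 + i3 - D * (2 * q)) - k * ((i2 + i3 - D * (2 * q)) * (i2 + i3 - D * (2 * q) - 1))))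
      = 8 * p\<^sup>2 * h * (u * v * r * t + h * u * u * q * (k * (2 * (i2 + i3) - 1) - 2 * j - k * D * (2 * q)))"
      unfolding I unfolding t by (simp add: D_def E_def algebra_simps power2_eq_square)
    show "j + j2 - k * i2 + j3 - (k + k2 + E * (2 * r)) * i3 - (j + (j2 + j3 - k2 * i3) - k * (i2 + i3 - D * (2 * q)))
      = 2 * p * (- (v * r * i3 + 2 * k * h * u * q))"
      unfolding J by (simp add: D_def E_def algebra_simps)
    show "k + k2 + E * (2 * r) + k3 + E * (i3 * ((k + k2 + E * (2 * r)) * (k + k2 + E * (2 * r) + 1)) - 2 * (k + k2 + E * (2 * r)) * j3)
      - (k + (k2 + k3 + E * (i3 * (k2 * (k2 + 1)) - 2 * k2 * j3)) + E * ((i2 + i3 - D * (2 * q)) * (k * (k + 1)) - 2 * k * (j2 + j3 - k2 * i3)))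
      + p * (j + j2 - k * i2 + j3 - (k + k2 + E * (2 * r)) * i3 - (j + (j2 + j3 - k2 * i3) - k * (i2 + i3 - D * (2 * q))))
      = 4 * p\<^sup>2 * (v * r * (v1 * i3 + v * (i3 * (k + k2 + E * r) - j3)) + 2 * v * h * u * q * s - k * h * u * q)"
      unfolding K J unfolding s by (simp add: D_def E_def v1 algebra_simps power2_eq_square)
  qed
qed

lemma H_simps: "carrier H = range red" "x \<otimes>\<^bsub>H\<^esub> y = red (prd x y)" "\<one>\<^bsub>H\<^esub> = (0, 0, 0)"
  by (simp_all add: H_def)

lemma red_0: "red (0, 0, 0) = (0, 0, 0)" by (simp add: red_def)

lemma prd_0: "prd (0, 0, 0) x = x" "prd x (0, 0, 0) = x"
  by (cases x; simp add: prd_def)+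

lemma monoid_H: "monoid H"
proof
  show "\<one>\<^bsub>H\<^esub> \<in> carrier H" unfolding H_simps by (metis rangeI red_0)
  fix x y z assume "x \<in> carrier H" "y \<in> carrier H" "z \<in> carrier H"
  show "x \<otimes>\<^bsub>H\<^esub> y \<otimes>\<^bsub>H\<^esub> z = x \<otimes>\<^bsub>H\<^esub> (y \<otimes>\<^bsub>H\<^esub> z)"
    unfolding H_simps using prd_assoc[of x y z] by (simp add: rel_iff_red)
qed (auto simp: H_simps prd_0)

section \<open>The generators of the model and its group structure\<close>

definition ga where "ga i = red (i, 0, 0)"
definition gb where "gb k = red (0, k, 0)"
definition gc where "gc j = red (0, 0, j)"

lemma g_closed [simp]: "ga i \<in> carrier H" "gb i \<in> carrier H" "gc i \<in> carrier H"
  by (auto simp: ga_def gb_def gc_def H_simps)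

lemma g_add: "ga (i + j) = ga i \<otimes>\<^bsub>H\<^esub> ga j" "gb (i + j) = gb i \<otimes>\<^bsub>H\<^esub> gb j" "gc (i + j)
    = gc i \<otimes>\<^bsub>H\<^esub> gc j"
  by (simp_all add: ga_def gb_def gc_def H_simps) (simp_all add: prd_def)

lemma g_zero: "ga 0 = \<one>\<^bsub>H\<^esub>" "gb 0 = \<one>\<^bsub>H\<^esub>" "gc 0 = \<one>\<^bsub>H\<^esub>"
  by (simp_all add: ga_def gb_def gc_def H_simps red_0)

lemma red_normal_form: "red (i, k, j) = ga i \<otimes>\<^bsub>H\<^esub> gc j \<otimes>\<^bsub>H\<^esub> gb k"
  by (simp add: ga_def gb_def gc_def H_simps) (simp add: prd_def)

text \<open>No inverse formula is needed: \<open>ga\<close>, \<open>gb\<close> and \<open>gc\<close>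
  turn sums of integers into products, so their values are units, and every element is a product of
  three of them.\<close>

lemma group_H: "group H"
proof -
  interpret monoid H by (rule monoid_H)
  have unit: "f i \<in> Units H"
    if "\<And>i. f i \<in> carrier H" "\<And>i j. f (i + j) = f i \<otimes>\<^bsub>H\<^esub> f j" "f 0 = \<one>\<^bsub>H\<^esub>"
        for f :: "int \<Rightarrow> triple" and i
  proof -
    have "f (- i) \<otimes>\<^bsub>H\<^esub> f i = \<one>\<^bsub>H\<^esub>" "f i \<otimes>\<^bsub>H\<^esub> f (- i) = \<one>\<^bsub>H\<^esub>"
      using that(2)[of "- i" i] that(2)[of i "- i"] that(3) by simp_all
    then show ?thesis unfolding Units_def using that(1)[of i] that(1)[of "- i"] by blast
  qed
  have U: "ga i \<in> Units H" "gb i \<in> Units H" "gc i \<in> Units H" for i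
    using unit[of ga, OF g_closed(1) g_add(1) g_zero(1)] unit[of gb, OF g_closed(2) g_add(2) g_zero(2)]
      unit[of gc, OF g_closed(3) g_add(3) g_zero(3)] by auto
  show ?thesis
  proof
    show "carrier H \<subseteq> Units H"
    proof
      fix x assume "x \<in> carrier H"
      then obtain i k j where "x = red (i, k, j)" by (auto simp: H_simps)
      then show "x \<in> Units H" unfolding red_normal_form using U by simp
    qed
  qed
qed

end

lemma (in group) int_pow_of_add:
  assumes c: "\<And>i. f i \<in> carrier G" and add: "\<And>i j::int. f (i + j) = f i \<otimes> f j"
  shows "f 1 [^] (i::int) = f i"
proof -
  have "f 0 \<otimes> f 0 = f 0 \<otimes> \<one>" using add[of 0 0] c by simp
  then have 0: "f 0 = \<one>" by (rule l_cancelD[rotated 3]) (use c in simp_all)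
  have nat: "f 1 [^] k = f (int k)" for k :: nat
    by (induction k) (simp_all add: 0 add add.commute[of 1])
  show ?thesis
  proof (cases "i \<ge> 0")
    case True
    then show ?thesis using nat[of "nat i"] by simp
  next
    case False
    have "f i \<otimes> f (- i) = \<one>" using add[of i "- i"] 0 by simp
    then have "f i = inv (f (- i))" using c by (simp add: inv_equality)
    also have "f (- i) = f 1 [^] (- i)" using nat[of "nat (- i)"] False by simp
    finally show ?thesis using c by (simp add: int_pow_neg)
  qed
qed

lemma (in macdonald) gcomm_eq_C: "gcomm G A B = C" "gcomm G B A = inv C"
proof -
  have "inv A \<otimes> inv B \<otimes> (A \<otimes> B) = inv A \<otimes> inv B \<otimes> (B \<otimes> A \<otimes> C)" by (simp only: AB)
  also have "\<dots> = inv (B \<otimes> A) \<otimes> (B \<otimes> A) \<otimes> C" by (simp add: m_assoc inv_mult_group del: l_inv)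
  finally show 1: "gcomm G A B = C" unfolding gcomm_def by (simp add: m_assoc)
  have "gcomm G B A = inv (gcomm G A B)" unfolding gcomm_def by (simp add: inv_mult_group m_assoc)
  then show "gcomm G B A = inv C" using 1 by simp
qed

lemma (in macdonald) rels: "rels G \<alpha> \<beta> A B"
proof -
  have "inv C \<otimes> (A \<otimes> C) = A [^] \<alpha>" unfolding AC by (simp flip: m_assoc)
  moreover have "(C \<otimes> B) \<otimes> inv C = B [^] \<beta>" unfolding CB by (simp add: m_assoc)
  ultimately show ?thesis unfolding rels_def gconj_def gcomm_eq_C by (simp add: m_assoc)
qed

lemma macdonaldI:
  fixes G (structure)
  assumes "group G" "A \<in> carrier G" "B \<in> carrier G" "rels G \<alpha> \<beta> A B"
  shows "macdonald G A B (gcomm G A B) \<alpha> \<beta>"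
proof -
  interpret group G by fact
  note [simp] = assms(2,3)
  define C where "C = gcomm G A B"
  have C [simp]: "C \<in> carrier G" by (simp add: C_def gcomm_def)
  have "gcomm G B A = inv C" unfolding C_def gcomm_def by (simp add: inv_mult_group m_assoc)
  then have r: "inv C \<otimes> A \<otimes> C = A [^] \<alpha>" "C \<otimes> B \<otimes> inv C = B [^] \<beta>"
    using assms(4) by (simp_all add: rels_def gconj_def C_def[symmetric])
  show ?thesis unfolding C_def[symmetric]
  proof unfold_locales
    show "A \<otimes> C = C \<otimes> A [^] \<alpha>" unfolding r(1)[symmetric] by (simp flip: m_assoc)
    show "C \<otimes> B = B [^] \<beta> \<otimes> C" unfolding r(2)[symmetric] by (simp add: m_assoc)
    have "B \<otimes> A \<otimes> C = (B \<otimes> A) \<otimes> inv (B \<otimes> A) \<otimes> (A \<otimes> B)"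
      unfolding C_def gcomm_def by (simp add: m_assoc inv_mult_group del: r_inv)
    then show "A \<otimes> B = B \<otimes> A \<otimes> C" by simp
  qed auto
qed

context macdonald_model
begin

interpretation H: group H by (rule group_H)

lemma g_pow: "ga 1 [^]\<^bsub>H\<^esub> (i::int) = ga i" "gb 1 [^]\<^bsub>H\<^esub> (i::int) = gb i" "gc 1 [^]\<^bsub>H\<^esub> (i::int)
    = gc i"
  using H.int_pow_of_add[of ga, OF g_closed(1) g_add(1)] H.int_pow_of_add[of gb, OF g_closed(2) g_add(2)]
    H.int_pow_of_add[of gc, OF g_closed(3) g_add(3)] by auto

lemma macdonald_H: "macdonald H (ga 1) (gb 1) (gc 1) (1 + 4 * p * h * u) (1 + 2 * p * v)"
proof unfold_locales
  \<comment> \<open>Here \<alpha> (2 - \<alpha>) = 1 - (\<alpha> - 1)^2, and (4 p h u)^2 is a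
    multiple of 8 p^2 h. The other two relations leave (2 p v)^2 in the same way.\<close>
  have "rel (prd (1, 0, 0) (0, 0, 1)) (prd (0, 0, 1) (1 + 4 * p * h * u, 0, 0))"
    unfolding prd_def prod.case
    by (rule relI[of _ _ "- 2 * h * u * u" _ _ _ _ 0 0]) (simp_all add: algebra_simps power2_eq_square)
  then show "ga 1 \<otimes>\<^bsub>H\<^esub> gc 1 = gc 1 \<otimes>\<^bsub>H\<^esub> ga 1 [^]\<^bsub>H\<^esub> (1 + 4 * p * h * u)"
    unfolding g_pow by (simp add: ga_def gc_def H_simps rel_iff_red)
  have "rel (prd (0, 0, 1) (0, 1, 0)) (prd (0, 1 + 2 * p * v, 0) (0, 0, 1))"
    unfolding prd_def prod.case
    by (rule relI[of _ _ 0 _ _ _ _ "- v * v" 0]) (simp_all add: algebra_simps power2_eq_square)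
  then show "gc 1 \<otimes>\<^bsub>H\<^esub> gb 1 = gb 1 [^]\<^bsub>H\<^esub> (1 + 2 * p * v) \<otimes>\<^bsub>H\<^esub> gc 1"
    unfolding g_pow by (simp add: gb_def gc_def H_simps rel_iff_red)
  have "rel (prd (1, 0, 0) (0, 1, 0)) (prd (prd (0, 1, 0) (1, 0, 0)) (0, 0, 1))"
    unfolding prd_def prod.case
    by (rule relI[of _ _ 0 _ _ _ _ "- v * v" 0]) (simp_all add: algebra_simps power2_eq_square)
  then show "ga 1 \<otimes>\<^bsub>H\<^esub> gb 1 = gb 1 \<otimes>\<^bsub>H\<^esub> ga 1 \<otimes>\<^bsub>H\<^esub> gc 1"
    by (simp add: ga_def gb_def gc_def H_simps rel_iff_red)
qed auto

section \<open>The orders of the model and of its generators\<close>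

lemma carrier_H: "bij_betw (\<lambda>(i, k, j). (i, k - p * j, j))
  ({0..<8 * p^2 * h} \<times> {0..<4 * p^2} \<times> {0..<2 * p}) (carrier H)"
proof (rule bij_betw_imageI)
  show "inj_on (\<lambda>(i, k, j). (i, k - p * j, j)) ({0..<8 * p^2 * h} \<times> {0..<4 * p^2} \<times> {0..<2 * p})"
    by (auto simp: inj_on_def)
  show "(\<lambda>(i, k, j). (i, k - p * j, j)) ` ({0..<8 * p^2 * h} \<times> {0..<4 * p^2} \<times> {0..<2 * p})
      = carrier H"
  proof (intro equalityI subsetI)
    fix x assume "x \<in> (\<lambda>(i, k, j). (i, k - p * j, j)) ` ({0..<8 * p^2 * h} \<times> {0..<4 * p^2} \<times> {0..<2 * p})"
    then obtain i k j
        where "x = (i, k - p * j, j)" "0 \<le> i" "i < 8 * p^2 * h" "0 \<le> k" "k < 4 * p^2" "0 \<le> j" "j < 2 * p"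
      by auto
    then have "red x = x" by (simp add: red_def)
    then show "x \<in> carrier H" by (metis H_simps(1) rangeI)
  next
    fix x assume "x \<in> carrier H"
    then obtain i k j where "x = red (i, k, j)" by (auto simp: H_simps)
    then show "x \<in> (\<lambda>(i, k, j). (i, k - p * j, j)) ` ({0..<8 * p^2 * h} \<times> {0..<4 * p^2} \<times> {0..<2 * p})"
      using p h by (intro image_eqI[of _ _ "(i mod (8 * p^2 * h), (k + p * j) mod (4 * p^2), j mod (2 * p))"])
        (auto simp: red_def)
  qed
qed

lemma card_H: "int (card (carrier H)) = 8 * p^2 * h * (4 * p^2) * (2 * p)"
proof -
  have "card (carrier H) = nat (8 * p^2 * h) * (nat (4 * p^2) * nat (2 * p))"
    using bij_betw_same_card[OF carrier_H] by (simp add: card_cartesian_product)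
  then show ?thesis using p h by simp
qed

lemma generate_H: "generate H {ga 1, gb 1} = carrier H"
proof
  interpret M: macdonald H "ga 1" "gb 1" "gc 1" "1 + 4 * p * h * u" "1 + 2 * p * v"
      by (rule macdonald_H)
  show "generate H {ga 1, gb 1} \<subseteq> carrier H" using H.generate_incl[of "{ga 1, gb 1}"] by simp
  interpret K: subgroup "generate H {ga 1, gb 1}" H by (rule H.generate_is_subgroup) simp
  have ab: "ga 1 \<in> generate H {ga 1, gb 1}" "gb 1 \<in> generate H {ga 1, gb 1}"
      by (auto intro: generate.incl)
  then have c: "gc 1 \<in> generate H {ga 1, gb 1}"
    unfolding M.gcomm_eq_C(1)[symmetric] gcomm_def by simp
  note pw = H.subgroup_int_pow_closed[OF K.subgroup_axioms]
  show "carrier H \<subseteq> generate H {ga 1, gb 1}"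
  proof
    fix x assume "x \<in> carrier H"
    then obtain i k j where "x = red (i, k, j)" by (auto simp: H_simps)
    then show "x \<in> generate H {ga 1, gb 1}"
      unfolding red_normal_form using pw[OF ab(1), of i] pw[OF ab(2), of k] pw[OF c, of j]
      by (simp add: g_pow)
  qed
qed

lemma eq_one_iff: "red (i, k, j) = \<one>\<^bsub>H\<^esub> \<longleftrightarrow> 8 * p^2 * h dvd i \<and> 4 * p^2 dvd k + p * j \<and> 2 * p dvd j"
  using rel_iff_red[of "(0, 0, 0)" "(i, k, j)"] by (auto simp: H_simps red_0 rel_def)

lemma ord_H:
  "int (H.ord (ga 1)) = 8 * p^2 * h" "int (H.ord (gb 1)) = 4 * p^2" "int (H.ord (gc 1)) = 4 * p"
proof -
  have "H.ord (ga 1) = nat (8 * p^2 * h)"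
  proof (rule H.ord_unique[THEN iffD2, rule_format])
    fix k :: nat
    have "ga 1 [^]\<^bsub>H\<^esub> k = ga (int k)" using g_pow(1)[of "int k"] by (simp add: int_pow_int)
    then show "ga 1 [^]\<^bsub>H\<^esub> k = \<one>\<^bsub>H\<^esub> \<longleftrightarrow> nat (8 * p^2 * h) dvd k"
      using p h by (simp add: ga_def eq_one_iff nat_dvd_iff)
  qed simp
  then show "int (H.ord (ga 1)) = 8 * p^2 * h" using p h by simp
  have "H.ord (gb 1) = nat (4 * p^2)"
  proof (rule H.ord_unique[THEN iffD2, rule_format])
    fix k :: nat
    have "gb 1 [^]\<^bsub>H\<^esub> k = gb (int k)" using g_pow(2)[of "int k"] by (simp add: int_pow_int)
    then show "gb 1 [^]\<^bsub>H\<^esub> k = \<one>\<^bsub>H\<^esub> \<longleftrightarrow> nat (4 * p^2) dvd k"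
      using p h by (simp add: gb_def eq_one_iff nat_dvd_iff)
  qed simp
  then show "int (H.ord (gb 1)) = 4 * p^2" using p h by simp
  \<comment> \<open>The order is twice the modulus 2 p of the third coordinate, because c^(2 p) =
    b^(2 p^2) is not trivial.\<close>
  have "H.ord (gc 1) = nat (4 * p)"
  proof (rule H.ord_unique[THEN iffD2, rule_format])
    fix k :: nat
    have "gc 1 [^]\<^bsub>H\<^esub> k = gc (int k)" using g_pow(3)[of "int k"] by (simp add: int_pow_int)
    moreover have "4 * p^2 dvd p * int k \<longleftrightarrow> 4 * p dvd int k"
      using dvd_mult_cancel_left[of p "4 * p" "int k"] p
          by (simp add: power2_eq_square mult.left_commute)
    moreover have "2 * p dvd int k" if "4 * p dvd int k" using that by (auto elim!: dvdE)
    ultimately show "gc 1 [^]\<^bsub>H\<^esub> k = \<one>\<^bsub>H\<^esub> \<longleftrightarrow> nat (4 * p) dvd k"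
      using p h by (auto simp: gc_def eq_one_iff nat_dvd_iff)
  qed simp
  then show "int (H.ord (gc 1)) = 4 * p" using p h by simp
qed

end

section \<open>The nilpotency class of the model\<close>

lemma (in group) gcomm_closed: "x \<in> carrier G \<Longrightarrow> y \<in> carrier G \<Longrightarrow> gcomm G x y \<in> carrier G"
  by (simp add: gcomm_def)

lemma (in group) gcomm_eq: "x \<in> carrier G \<Longrightarrow> y \<in> carrier G \<Longrightarrow> y \<otimes> x \<otimes> gcomm G x y = x \<otimes> y"
proof -
  assume [simp]: "x \<in> carrier G" "y \<in> carrier G"
  have "y \<otimes> x \<otimes> gcomm G x y = (y \<otimes> x) \<otimes> inv (y \<otimes> x) \<otimes> (x \<otimes> y)"
    unfolding gcomm_def by (simp add: m_assoc inv_mult_group del: r_inv)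
  then show ?thesis by simp
qed

lemma (in group) gcomm_eq_one_iff:
  "x \<in> carrier G \<Longrightarrow> y \<in> carrier G \<Longrightarrow> gcomm G x y = \<one> \<longleftrightarrow> x \<otimes> y = y \<otimes> x"
  using gcomm_eq[of x y] gcomm_closed[of x y] by (metis l_cancelD m_closed one_closed r_one)

lemma dvd_diffD: "d dvd a - b \<Longrightarrow> d dvd b \<Longrightarrow> d dvd a" for a b d :: int
  using dvd_add[of d "a - b" b] by simp

context macdonald_model
begin

interpretation H: group H by (rule group_H)

text \<open>Modulo 4 p h, 2 p and 2 p all corrections vanish except the bilinear one in the third
  coordinate: a multiplication of Heisenberg type.\<close>

lemma coords_mult:
  fixes i k j i' k' j' I K J :: int
  assumes "(i, k, j) \<otimes>\<^bsub>H\<^esub> (i', k', j') = (I, K, J)"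
  shows "4 * p * h dvd I - (i + i')" "2 * p dvd K - (k + k')" "2 * p dvd J - (j + j' - k * i')"
proof -
  obtain t where t: "i' * (i' - 1) = 2 * t" by (rule even_pronic)
  obtain s where s: "k * (k + 1) = 2 * s" by (rule even_pronic')
  have "rel (prd (i, k, j) (i', k', j')) (I, K, J)"
    using rel_red[of "prd (i, k, j) (i', k', j')"] assms by (simp add: H_simps)
  then have "rel (i + i' - 2 * p * h * u * (2 * j * i' - k * (2 * t)),
      k + k' + p * v * (i' * (2 * s) - 2 * k * j'), j + j' - k * i') (I, K, J)"
    unfolding prd_def prod.case t s .
  then obtain a b c
      where abc: "(I, K, J)
      = (i + i' - 2 * p * h * u * (2 * j * i' - k * (2 * t)) + 8 * p^2 * h * a,
      k + k' + p * v * (i' * (2 * s) - 2 * k * j') + 2 * p^2 * (2 * b - c), j + j' - k * i' + 2 * p * c)"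
    by (rule relE)
  have "I - (i + i') = 4 * p * h * (2 * p * a - u * (j * i' - k * t))"
    using abc by (simp add: algebra_simps power2_eq_square)
  then show "4 * p * h dvd I - (i + i')" by simp
  have "K - (k + k') = 2 * p * (v * (i' * s - k * j') + p * (2 * b - c))"
    using abc by (simp add: algebra_simps power2_eq_square)
  then show "2 * p dvd K - (k + k')" by simp
  show "2 * p dvd J - (j + j' - k * i')" using abc by simp
qed

definition cI :: "triple \<Rightarrow> int" where "cI x = fst x"
definition cK :: "triple \<Rightarrow> int" where "cK x = fst (snd x)"
definition cJ :: "triple \<Rightarrow> int" where "cJ x = snd (snd x)"

lemma c_mult:
  "4 * p * h dvd cI (x \<otimes>\<^bsub>H\<^esub> y) - (cI x + cI y)"
  "2 * p dvd cK (x \<otimes>\<^bsub>H\<^esub> y) - (cK x + cK y)"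
  "2 * p dvd cJ (x \<otimes>\<^bsub>H\<^esub> y) - (cJ x + cJ y - cK x * cI y)"
  using coords_mult[of "cI x" "cK x" "cJ x" "cI y" "cK y" "cJ y" "cI (x \<otimes>\<^bsub>H\<^esub> y)" "cK (x \<otimes>\<^bsub>H\<^esub> y)" "cJ (x \<otimes>\<^bsub>H\<^esub> y)"]
  by (simp_all add: cI_def cK_def cJ_def)

lemma c_one: "cI \<one>\<^bsub>H\<^esub> = 0" "cK \<one>\<^bsub>H\<^esub> = 0" "cJ \<one>\<^bsub>H\<^esub> = 0"
  by (simp_all add: H_simps cI_def cK_def cJ_def)

lemma c_inv:
  assumes "x \<in> carrier H"
  shows "4 * p * h dvd cI (inv\<^bsub>H\<^esub> x) + cI x" "2 * p dvd cK (inv\<^bsub>H\<^esub> x) + cK x"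
    "2 * p dvd cJ x + cJ (inv\<^bsub>H\<^esub> x) - cK x * cI (inv\<^bsub>H\<^esub> x)"
proof -
  have e: "x \<otimes>\<^bsub>H\<^esub> inv\<^bsub>H\<^esub> x = \<one>\<^bsub>H\<^esub>" using assms by simp
  have "a dvd - (b + c) \<Longrightarrow> a dvd c + b" for a b c :: int by (metis add.commute dvd_minus_iff)
  then show "4 * p * h dvd cI (inv\<^bsub>H\<^esub> x) + cI x" "2 * p dvd cK (inv\<^bsub>H\<^esub> x) + cK x"
    using c_mult(1,2)[of x "inv\<^bsub>H\<^esub> x", unfolded e c_one] by simp_all
  show "2 * p dvd cJ x + cJ (inv\<^bsub>H\<^esub> x) - cK x * cI (inv\<^bsub>H\<^esub> x)"
    using c_mult(3)[of x "inv\<^bsub>H\<^esub> x", unfolded e c_one]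
    by (metis diff_0 dvd_minus_iff)
qed

lemma dvd_gcomm:
  fixes f :: "triple \<Rightarrow> int"
  assumes m: "\<And>x y. d dvd f (x \<otimes>\<^bsub>H\<^esub> y) - (f x + f y)"
      and i: "\<And>x. x \<in> carrier H \<Longrightarrow> d dvd f (inv\<^bsub>H\<^esub> x) + f x"
    and xy: "x \<in> carrier H" "y \<in> carrier H"
  shows "d dvd f (gcomm H x y)"
proof -
  define x' y' where "x' = inv\<^bsub>H\<^esub> x" and "y' = inv\<^bsub>H\<^esub> y"
  have "d dvd (f (x' \<otimes>\<^bsub>H\<^esub> y' \<otimes>\<^bsub>H\<^esub> x \<otimes>\<^bsub>H\<^esub> y) - (f (x' \<otimes>\<^bsub>H\<^esub> y' \<otimes>\<^bsub>H\<^esub> x) + f y))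
    + (f (x' \<otimes>\<^bsub>H\<^esub> y' \<otimes>\<^bsub>H\<^esub> x) - (f (x' \<otimes>\<^bsub>H\<^esub> y') + f x)) + (f (x' \<otimes>\<^bsub>H\<^esub> y') - (f x' + f y'))
    + (f x' + f x) + (f y' + f y)"
    unfolding x'_def y'_def
        by (rule dvd_add[OF dvd_add[OF dvd_add[OF dvd_add[OF m m] m] i[OF xy(1)]] i[OF xy(2)]])
  then show ?thesis unfolding gcomm_def x'_def y'_def by (simp add: algebra_simps)
qed

text \<open>{1}, \<open>Z1\<close>, \<open>Z2\<close> and the whole group form a central series, so
  these two subgroups bound the second and third terms of the lower central series from
  above.\<close>

definition Z2 where "Z2 = {x \<in> carrier H. 4 * p * h dvd cI x \<and> 2 * p dvd cK x}"
definition Z1 where "Z1 = {x \<in> Z2. 2 * p dvd cJ x}"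

lemma gcomm_Z2: "x \<in> carrier H \<Longrightarrow> y \<in> carrier H \<Longrightarrow> gcomm H x y \<in> Z2"
  unfolding Z2_def
      using dvd_gcomm[of _ cI, OF c_mult(1) c_inv(1)] dvd_gcomm[of _ cK, OF c_mult(2) c_inv(2)]
  by (simp add: H.gcomm_closed)

lemma two_p_dvd: "4 * p * h dvd a \<Longrightarrow> 2 * p dvd a" for a
  by (auto elim!: dvdE)

lemma subgroup_Z2: "subgroup Z2 H"
proof (rule H.subgroupI)
  show "Z2 \<subseteq> carrier H" by (auto simp: Z2_def)
  have "\<one>\<^bsub>H\<^esub> \<in> Z2" by (simp add: Z2_def c_one)
  then show "Z2 \<noteq> {}" by blast
  fix x assume x: "x \<in> Z2"
  then show "inv\<^bsub>H\<^esub> x \<in> Z2"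
    using c_inv[of x] by (auto simp: Z2_def dvd_add_left_iff)
  fix y assume "y \<in> Z2"
  then show "x \<otimes>\<^bsub>H\<^esub> y \<in> Z2"
    using x dvd_diffD[OF c_mult(1)[of x y]] dvd_diffD[OF c_mult(2)[of x y]] by (auto simp: Z2_def)
qed

lemma subgroup_Z1: "subgroup Z1 H"
proof (rule H.subgroupI)
  interpret Z2: subgroup Z2 H by (rule subgroup_Z2)
  show "Z1 \<subseteq> carrier H" by (auto simp: Z1_def)
  have "\<one>\<^bsub>H\<^esub> \<in> Z1" by (simp add: Z1_def c_one)
  then show "Z1 \<noteq> {}" by blast
  fix x assume x: "x \<in> Z1"
  then have xc: "x \<in> carrier H" "2 * p dvd cK x" "2 * p dvd cJ x" unfolding Z1_def Z2_def by blast+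
  have "2 * p dvd cJ x + cJ (inv\<^bsub>H\<^esub> x)"
      by (rule dvd_diffD[OF c_inv(3)[OF xc(1)] dvd_mult2[OF xc(2)]])
  then have "2 * p dvd cJ (inv\<^bsub>H\<^esub> x)" using xc(3) by (simp only: dvd_add_right_iff)
  then show "inv\<^bsub>H\<^esub> x \<in> Z1" using x by (simp add: Z1_def)
  fix y assume y: "y \<in> Z1"
  then have "2 * p dvd cJ y" by (simp add: Z1_def)
  then have "2 * p dvd cJ x + cJ y - cK x * cI y" by (intro dvd_diff[OF dvd_add dvd_mult2] xc)
  from dvd_diffD[OF c_mult(3) this] show "x \<otimes>\<^bsub>H\<^esub> y \<in> Z1" using x y by (simp add: Z1_def)
qed

lemma gcomm_Z1:
  assumes z: "z \<in> Z2" and g: "g \<in> carrier H"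
  shows "gcomm H z g \<in> Z1"
proof -
  have zc: "z \<in> carrier H" using z by (simp add: Z2_def)
  define w where "w = gcomm H z g"
  have w: "w \<in> Z2" unfolding w_def by (rule gcomm_Z2[OF zc g])
  have e: "(g \<otimes>\<^bsub>H\<^esub> z) \<otimes>\<^bsub>H\<^esub> w = z \<otimes>\<^bsub>H\<^esub> g" unfolding w_def by (rule H.gcomm_eq[OF zc g])
  have z': "2 * p dvd cK z" "2 * p dvd cI z" "2 * p dvd cI w" using z w two_p_dvd
      by (auto simp: Z2_def)
  \<comment> \<open>The sum collapses to \<open>cJ w\<close>: the third coordinate of z g is
    computed directly and as that of (g z) w, and each bilinear term has a factor divisible by 2
    p.\<close>
  have "2 * p dvd (cJ (z \<otimes>\<^bsub>H\<^esub> g) - (cJ z + cJ g - cK z * cI g)) - (cJ (z \<otimes>\<^bsub>H\<^esub> g) - (cJ (g \<otimes>\<^bsub>H\<^esub> z) + cJ w - cK (g \<otimes>\<^bsub>H\<^esub> z) * cI w))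
    - (cJ (g \<otimes>\<^bsub>H\<^esub> z) - (cJ g + cJ z - cK g * cI z)) - cK z * cI g + cK (g \<otimes>\<^bsub>H\<^esub> z) * cI w + cK g * cI z"
    using c_mult(3)[of z g] c_mult(3)[of "g \<otimes>\<^bsub>H\<^esub> z" w] c_mult(3)[of g z] z'
    unfolding e by (meson dvd_add dvd_diff dvd_mult dvd_mult2)
  then have "2 * p dvd cJ w" by (simp add: algebra_simps)
  then show ?thesis using w unfolding w_def Z1_def by simp
qed

lemma Z1_central:
  assumes z: "z \<in> Z1" and g: "g \<in> carrier H"
  shows "z \<otimes>\<^bsub>H\<^esub> g = g \<otimes>\<^bsub>H\<^esub> z"
proof -
  obtain i k j where zz: "z = (4 * p * h * i, 2 * p * k, 2 * p * j)"
    using z by (cases z) (auto simp: Z1_def Z2_def cI_def cK_def cJ_def elim!: dvdE)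
  obtain i2 k2 j2 where gg: "g = (i2, k2, j2)" by (cases g)
  obtain t where t: "i2 * (i2 - 1) = 2 * t" by (rule even_pronic)
  \<comment> \<open>As for associativity, v - 1 even supplies the missing factor 2 in the second
    component.\<close>
  obtain v1 where v1: "v = 2 * v1 + 1" using v by (elim oddE)
  have "rel (prd g z) (prd z g)"
    unfolding zz gg prd_def prod.case t
    by (rule relI[where a = "- u * j * i2 + u * k * t + 2 * u * h * j2 * i - u * h * k2 * i * (4 * p * h * i - 1)"
        and c = "k2 * 2 * h * i - k * i2"
        and b = "i2 * k * (v1 + p * k * v) - v * k * j2 - v * h * i * (k2 * (k2 + 1)) + v * k2 * j + k2 * h * i"])
      (simp_all add: v1 algebra_simps power2_eq_square)
  then show ?thesis by (simp add: H_simps rel_iff_red)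
qed

lemma generate_le_one: "S \<subseteq> {\<one>\<^bsub>H\<^esub>} \<Longrightarrow> generate H S = {\<one>\<^bsub>H\<^esub>}"
  using H.generate_subgroup_incl[OF _ H.triv_subgroup, of S] generate.one[of H S] by blast

lemma nilpotency_class_H: "nilpotency_class_is H 3"
proof -
  interpret M: macdonald H "ga 1" "gb 1" "gc 1" "1 + 4 * p * h * u" "1 + 2 * p * v"
      by (rule macdonald_H)
  have L2: "lcs H 2 \<subseteq> Z2"
    unfolding numeral_2_eq_2 lcs.simps comm_subgroup_def
    by (rule H.generate_subgroup_incl[OF _ subgroup_Z2]) (use gcomm_Z2 in auto)
  have L3: "lcs H 3 \<subseteq> Z1"
    using L2 gcomm_Z1
        unfolding numeral_3_eq_3 numeral_2_eq_2 lcs.simps(3)[of H "Suc 0"] comm_subgroup_def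
    by (intro H.generate_subgroup_incl[OF _ subgroup_Z1]) auto
  have "gcomm H x y = \<one>\<^bsub>H\<^esub>" if "x \<in> lcs H 3" "y \<in> carrier H" for x y
  proof -
    have "x \<in> Z1" using that L3 by auto
    moreover then have "x \<in> carrier H" by (simp add: Z1_def Z2_def)
    ultimately show ?thesis using Z1_central[of x y] that H.gcomm_eq_one_iff[of x y] by simp
  qed
  then have L4: "lcs H (Suc 3) = {\<one>\<^bsub>H\<^esub>}"
    unfolding numeral_3_eq_3 lcs.simps(3)[of H "Suc (Suc 0)"] comm_subgroup_def
        by (intro generate_le_one) auto
  have c2: "gc 1 \<in> lcs H 2"
    unfolding numeral_2_eq_2 lcs.simps comm_subgroup_def M.gcomm_eq_C(1)[symmetric]
    using g_closed by (intro generate.incl) blast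
  have c3: "gcomm H (gc 1) (ga 1) \<in> lcs H 3"
    using c2 g_closed(1)
        unfolding numeral_3_eq_3 numeral_2_eq_2 lcs.simps(3)[of H "Suc 0"] comm_subgroup_def
    by (intro generate.incl) blast
  have n2: "gc 1 \<noteq> \<one>\<^bsub>H\<^esub>"
    using p by (auto simp: gc_def eq_one_iff zdvd1_eq)
  have n3: "gcomm H (gc 1) (ga 1) \<noteq> \<one>\<^bsub>H\<^esub>"
  proof
    assume "gcomm H (gc 1) (ga 1) = \<one>\<^bsub>H\<^esub>"
    then have "gc 1 \<otimes>\<^bsub>H\<^esub> ga 1 = ga 1 \<otimes>\<^bsub>H\<^esub> gc 1" by (simp add: H.gcomm_eq_one_iff)
    then have "gc 1 \<otimes>\<^bsub>H\<^esub> ga 1 = gc 1 \<otimes>\<^bsub>H\<^esub> ga (1 + 4 * p * h * u)" using M.AC by (simp add: g_pow)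
    then have "ga 1 \<otimes>\<^bsub>H\<^esub> \<one>\<^bsub>H\<^esub> = ga 1 \<otimes>\<^bsub>H\<^esub> ga (4 * p * h * u)" by (simp add: g_add)
    then have "\<one>\<^bsub>H\<^esub> = ga (4 * p * h * u)" by (rule H.l_cancelD[rotated 3]) simp_all
    then have "8 * p^2 * h dvd 4 * p * h * u" using eq_one_iff[of "4 * p * h * u" 0 0]
        by (simp add: ga_def)
    then have "(4 * p * h) * (2 * p) dvd (4 * p * h) * u"
        by (simp add: power2_eq_square algebra_simps)
    then have "2 * p dvd u" using p h by (simp only: dvd_mult_cancel_left) auto
    then show False using u by (metis dvd_mult_left)
  qed
  have ne: "lcs H (Suc 0) \<noteq> {\<one>\<^bsub>H\<^esub>}" "lcs H 2 \<noteq> {\<one>\<^bsub>H\<^esub>}" "lcs H 3 \<noteq> {\<one>\<^bsub>H\<^esub>}"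
    unfolding lcs.simps(2) using g_closed(3)[of 1] n2 n3 c2 c3 by blast+
  have "lcs H (Suc d) \<noteq> {\<one>\<^bsub>H\<^esub>}" if "d < 3" for d
  proof -
    have "Suc d = Suc 0 \<or> Suc d = 2 \<or> Suc d = 3" using that by linarith
    then show ?thesis using ne by metis
  qed
  then show ?thesis unfolding nilpotency_class_is_def using L4 by blast
qed

end

section \<open>Sylow 2-subgroups of the presented group\<close>

context group_hom
begin

lemma hom_gcomm: "x \<in> carrier G \<Longrightarrow> y \<in> carrier G \<Longrightarrow> h (gcomm G x y) = gcomm H (h x) (h y)"
  by (simp add: gcomm_def)

lemma hom_gconj: "x \<in> carrier G \<Longrightarrow> y \<in> carrier G \<Longrightarrow> h (gconj G x y) = gconj H (h x) (h y)"
  by (simp add: gconj_def)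

lemma hom_rels:
  assumes "x \<in> carrier G" "y \<in> carrier G" "rels G \<alpha> \<beta> x y"
  shows "rels H \<alpha> \<beta> (h x) (h y)"
proof -
  have "h (gconj G x (gcomm G x y)) = h (x [^] \<alpha>)" "h (gconj G y (gcomm G y x)) = h (y [^] \<beta>)"
    using assms(3) by (simp_all add: rels_def)
  then show ?thesis using assms(1,2)
      by (simp add: rels_def hom_gconj hom_gcomm G.gcomm_closed hom_int_pow)
qed

lemma lcs_image:
  assumes "h ` carrier G = carrier H"
  shows "lcs G i \<subseteq> carrier G \<and> h ` lcs G i = lcs H i"
proof (induction i)
  case (Suc i)
  show ?case
  proof (cases i)
    case (Suc j)
    let ?S = "{gcomm G x y | x y. x \<in> lcs G i \<and> y \<in> carrier G}"
    have sub: "lcs G i \<subseteq> carrier G" and img: "h ` lcs G i = lcs H i" using Suc.IH by auto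
    have S: "?S \<subseteq> carrier G" using sub G.gcomm_closed by blast
    have "h ` ?S = {gcomm H x y | x y. x \<in> h ` lcs G i \<and> y \<in> h ` carrier G}"
    proof (intro equalityI subsetI)
      fix z assume "z \<in> h ` ?S"
      then obtain x y where xy: "x \<in> lcs G i" "y \<in> carrier G" "z = h (gcomm G x y)" by blast
      then have "z = gcomm H (h x) (h y)" using sub hom_gcomm by blast
      then show "z \<in> {gcomm H x y | x y. x \<in> h ` lcs G i \<and> y \<in> h ` carrier G}" using xy by blast
    next
      fix z assume "z \<in> {gcomm H x y | x y. x \<in> h ` lcs G i \<and> y \<in> h ` carrier G}"
      then obtain x y where xy: "x \<in> lcs G i" "y \<in> carrier G" "z = gcomm H (h x) (h y)" by blast
      then have "z = h (gcomm G x y)" using sub hom_gcomm by (metis subsetD)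
      then show "z \<in> h ` ?S" using xy by blast
    qed
    then have "h ` generate G ?S = generate H {gcomm H x y | x y. x \<in> lcs H i \<and> y \<in> carrier H}"
      unfolding generate_img[OF S, symmetric] img assms by simp
    then show ?thesis using G.generate_incl[OF S] by (simp add: Suc comm_subgroup_def)
  qed (use assms in simp)
qed (use assms in simp)

lemma nilpotency_class_is_of_inj:
  assumes surj: "h ` carrier G = carrier H" and inj: "inj_on h (carrier G)"
      and c: "nilpotency_class_is H c"
  shows "nilpotency_class_is G c"
proof -
  have "lcs G i = {\<one>} \<longleftrightarrow> lcs H i = {\<one>\<^bsub>H\<^esub>}" for i
  proof -
    have sub: "lcs G i \<subseteq> carrier G" and img: "h ` lcs G i = lcs H i" using lcs_image[OF surj, of i]
        by auto
    have "h ` {\<one>} = {\<one>\<^bsub>H\<^esub>}" by simp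
    then show ?thesis using inj_on_image_eq_iff[OF inj sub, of "{\<one>}"] img by simp
  qed
  then show ?thesis using c by (simp add: nilpotency_class_is_def)
qed

lemma order_eq_card_kernel:
  assumes "h ` carrier G = carrier H"
  shows "order G = card (kernel G H h) * order H"
proof -
  have "card (rcosets\<^bsub>G\<^esub> kernel G H h) = order H"
    using iso_same_card[OF FactGroup_iso[OF assms]] by (simp add: FactGroup_def order_def)
  then show ?thesis using G.lagrange[OF subgroup_kernel] by (simp add: mult.commute)
qed

end

lemma (in group) subgroup_pow_card:
  assumes "subgroup K G" "x \<in> K"
  shows "x [^] card K = \<one>"
  using group.pow_order_eq_1[OF subgroup_imp_group[OF assms(1)], of x] assms(2)
  by (simp add: order_def flip: nat_pow_consistent)

lemma (in group) eq_one_of_coprime_pow: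
  assumes "x \<in> carrier G" "x [^] (a::nat) = \<one>" "x [^] (b::nat) = \<one>" "coprime a b"
  shows "x = \<one>"
proof -
  have "ord x dvd 1" using assms pow_eq_id[OF assms(1)] by (metis coprime_common_divisor)
  then have "x [^] (1::nat) = \<one>" using pow_eq_id[OF assms(1)] by blast
  then show ?thesis using assms(1) by simp
qed

text \<open>The universal property tests only groups on the natural numbers; a group on a countable
  type, such as the triples of the model, is transported there along \<open>to_nat\<close>.\<close>

lemma presented_by_hom:
  fixes K :: "'k::countable monoid"
  assumes pres: "presented_by G A B \<alpha> \<beta>"
      and K: "group K" "x \<in> carrier K" "y \<in> carrier K" "rels K \<alpha> \<beta> x y"
  shows "\<exists>h \<in> hom G K. h A = x \<and> h B = y"
proof -
  define N where "N = image_group (to_nat :: 'k \<Rightarrow> nat) K"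
  have N: "group N" unfolding N_def by (rule group.inj_imp_image_group_is_group[OF K(1)]) simp
  have iso: "to_nat \<in> iso K N" unfolding N_def by (rule inj_imp_image_group_iso) simp
  have iso': "Hilbert_Choice.inv to_nat \<in> iso N K" unfolding N_def
      by (rule inj_imp_image_group_inv_iso) simp
  interpret to_nat: group_hom K N to_nat
    using K(1) N iso by (simp add: group_hom_def group_hom_axioms_def iso_def)
  obtain h where h: "h \<in> hom G N" "h A = to_nat x" "h B = to_nat y"
    using pres N to_nat.hom_rels[OF K(2-4)] to_nat.hom_closed K(2,3) unfolding presented_by_def
        by blast
  have "Hilbert_Choice.inv to_nat \<circ> h \<in> hom G K"
    using h(1) iso' by (intro hom_compose[of _ _ N]) (simp_all add: iso_def)
  then show ?thesis using h by (intro bexI[of _ "Hilbert_Choice.inv to_nat \<circ> h"]) simp_all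
qed

section \<open>Restriction of the quotient map to a Sylow 2-subgroup\<close>

locale two_quotient = group_hom G H h for G (structure) and H (structure) and h +
  fixes e :: nat and P
  assumes fin: "finite (carrier G)" and surj: "h ` carrier G = carrier H"
      and ordH: "order H = 2 ^ e"
    and ndvd: "\<not> 2 ^ Suc e dvd order G" and sylow: "sylow2 G P"
begin

lemma odd_card_kernel: "odd (card (kernel G H h))"
  using ndvd unfolding order_eq_card_kernel[OF surj] ordH by auto

lemma card_P: "card P = 2 ^ e"
proof -
  have "multiplicity (2::nat) (order G) = e"
    by (rule multiplicity_eqI) (use ndvd order_eq_card_kernel[OF surj] ordH in auto)
  then show ?thesis using sylow by (simp add: sylow2_def)
qed

lemma subgroup_P: "subgroup P G"
  using sylow by (simp add: sylow2_def)

lemma inj_on_P: "inj_on h P"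
proof (rule inj_onI)
  interpret P: subgroup P G by (rule subgroup_P)
  fix x y assume xy: "x \<in> P" "y \<in> P" "h x = h y"
  have z: "x \<otimes> inv y \<in> P" "x \<otimes> inv y \<in> carrier G" using xy by auto
  have "h (x \<otimes> inv y) = \<one>\<^bsub>H\<^esub>" using xy by simp
  then have "x \<otimes> inv y \<in> kernel G H h" using z by (simp add: kernel_def)
  then have "x \<otimes> inv y = \<one>"
    using G.eq_one_of_coprime_pow[OF z(2) G.subgroup_pow_card[OF subgroup_P z(1)] G.subgroup_pow_card[OF subgroup_kernel]]
      odd_card_kernel by (simp add: card_P)
  then show "x = y" using xy by (metis G.inv_equality G.inv_inv G.inv_closed P.mem_carrier)
qed

lemma image_P: "h ` P = carrier H"
proof (rule card_subset_eq)
  show "finite (carrier H)" using surj fin by (metis finite_imageI)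
  show "h ` P \<subseteq> carrier H" using subgroup.subset[OF subgroup_P] by auto
  show "card (h ` P) = card (carrier H)" using card_image[OF inj_on_P] card_P ordH
      by (simp add: order_def)
qed

lemma group_hom_P: "group_hom (G\<lparr>carrier := P\<rparr>) H h"
proof -
  interpret P: subgroup P G by (rule subgroup_P)
  have "h \<in> hom (G\<lparr>carrier := P\<rparr>) H" by (rule homI) simp_all
  then show ?thesis
    using G.subgroup_imp_group[OF subgroup_P] H.is_group
        by (simp add: group_hom_def group_hom_axioms_def)
qed

lemma nilpotency_class_P: "nilpotency_class_is H c \<Longrightarrow> nilpotency_class_is (G\<lparr>carrier := P\<rparr>) c"
  by (rule group_hom.nilpotency_class_is_of_inj[OF group_hom_P]) (simp_all add: image_P inj_on_P)

text \<open>The kernel of the retraction has odd order, so y = \<pi>(g)^(-1) g has odd order; its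
  image in the 2-group H is then trivial. Thus orders of projected elements can be read off in the
  model.\<close>

lemma hom_retraction:
  assumes \<pi>: "\<pi> \<in> hom G (G\<lparr>carrier := P\<rparr>)" "\<forall>x \<in> P. \<pi> x = x" and g: "g \<in> carrier G"
  shows "\<pi> g \<in> P" "h (\<pi> g) = h g"
proof -
  interpret R: group_hom G "G\<lparr>carrier := P\<rparr>" \<pi>
    using G.subgroup_imp_group[OF subgroup_P] G.is_group \<pi>(1)
        by (simp add: group_hom_def group_hom_axioms_def)
  interpret P: subgroup P G by (rule subgroup_P)
  show \<pi>g: "\<pi> g \<in> P" using R.hom_closed[OF g] by simp
  define y where "y = inv (\<pi> g) \<otimes> g"
  have y: "y \<in> carrier G" using g \<pi>g by (simp add: y_def)
  have "\<pi> ` carrier G = carrier (G\<lparr>carrier := P\<rparr>)"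
  proof
    show "\<pi> ` carrier G \<subseteq> carrier (G\<lparr>carrier := P\<rparr>)" using R.hom_closed by auto
    show "carrier (G\<lparr>carrier := P\<rparr>) \<subseteq> \<pi> ` carrier G" using \<pi>(2) P.subset by force
  qed
  from R.order_eq_card_kernel[OF this] have "order G = card (kernel G (G\<lparr>carrier := P\<rparr>) \<pi>) * 2 ^ e"
    using card_P by (simp add: order_def)
  then have odd: "odd (card (kernel G (G\<lparr>carrier := P\<rparr>) \<pi>))" using ndvd by auto
  have "\<pi> y = inv (\<pi> g) \<otimes> \<pi> g" using R.hom_mult[of "inv (\<pi> g)" g] \<pi>(2) \<pi>g g by (simp add: y_def)
  then have "y \<in> kernel G (G\<lparr>carrier := P\<rparr>) \<pi>" using \<pi>g y by (simp add: kernel_def)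
  then have "y [^] card (kernel G (G\<lparr>carrier := P\<rparr>) \<pi>) = \<one>"
    by (rule G.subgroup_pow_card[OF R.subgroup_kernel])
  then have "h y [^]\<^bsub>H\<^esub> card (kernel G (G\<lparr>carrier := P\<rparr>) \<pi>) = \<one>\<^bsub>H\<^esub>"
    using y by (metis hom_nat_pow hom_one)
  moreover have "h y [^]\<^bsub>H\<^esub> (2 ^ e :: nat) = \<one>\<^bsub>H\<^esub>"
    using H.pow_order_eq_1[of "h y"] y ordH by simp
  ultimately have "h y = \<one>\<^bsub>H\<^esub>" using H.eq_one_of_coprime_pow[of "h y"] y odd by simp
  then have 1: "inv\<^bsub>H\<^esub> (h (\<pi> g)) \<otimes>\<^bsub>H\<^esub> h g = \<one>\<^bsub>H\<^esub>" using g \<pi>g by (simp add: y_def)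
  then have "inv\<^bsub>H\<^esub> (inv\<^bsub>H\<^esub> (h (\<pi> g))) = h g"
    using g \<pi>g by (metis H.inv_comm H.inv_equality H.inv_closed P.mem_carrier hom_closed)
  then show "h (\<pi> g) = h g" using \<pi>g by simp
qed

lemma ord_P:
  assumes "x \<in> P"
  shows "G.ord x = H.ord (h x)"
proof -
  interpret P: subgroup P G by (rule subgroup_P)
  have x: "x \<in> carrier G" using assms by simp
  have "x [^] k = \<one> \<longleftrightarrow> h x [^]\<^bsub>H\<^esub> k = \<one>\<^bsub>H\<^esub>" for k :: nat
  proof -
    have "x [^] k \<in> P" using assms by (induction k) auto
    then have "x [^] k = \<one> \<longleftrightarrow> h (x [^] k) = h \<one>" using inj_on_eq_iff[OF inj_on_P _ P.one_closed]
        by metis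
    then show ?thesis using x by (simp add: hom_nat_pow)
  qed
  then show ?thesis using G.ord_unique[OF x] H.pow_eq_id[OF hom_closed[OF x]] by simp
qed

end

theorem theorem14p1:
  fixes G :: "('g, 'z) monoid_scheme" and A B :: 'g and \<alpha> \<beta> :: int
  assumes "\<alpha> \<noteq> 1" and "\<beta> \<noteq> 1"
    and pres: "presented_by G A B \<alpha> \<beta>"
    and "n = multiplicity (2::int) (\<beta> - 1)"
    and "m = multiplicity (2::int) (\<alpha> - 1)"
    and "l = multiplicity (2::int) (\<alpha> - \<beta>)"
    and "n > 1" and "m > n" and "n = l"
  shows "finite (carrier G) \<and>
    (\<forall>P. sylow2 G P \<longrightarrow>
       card P = 2 ^ (m + 4 * n) \<and>
       nilpotency_class_is (G\<lparr>carrier := P\<rparr>) 3 \<and>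
       (\<forall>\<pi> \<in> hom G (G\<lparr>carrier := P\<rparr>). (\<forall>x \<in> P. \<pi> x = x) \<longrightarrow>
          group.ord G (\<pi> A) = 2 ^ (m + n) \<and>
          group.ord G (\<pi> B) = 2 ^ (2 * n) \<and>
          group.ord G (\<pi> (gcomm G A B)) = 2 ^ (n + 1)))"
proof -
  have G: "group G" "A \<in> carrier G" "B \<in> carrier G" "generate G {A, B} = carrier G" "rels G \<alpha> \<beta> A B"
    using pres by (auto simp: presented_by_def)
  interpret macdonald G A B "gcomm G A B" \<alpha> \<beta> by (rule macdonaldI[OF G(1-3,5)])
  have "\<alpha> \<noteq> \<beta>" using assms(6,7,9) by auto
  then have vm: "val2 m (\<alpha> - 1)" and vn: "val2 n (\<beta> - 1)" and vd: "val2 n (\<alpha> - \<beta>)"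
    using val2_multiplicity[of "\<alpha> - 1"] val2_multiplicity[of "\<beta> - 1"] val2_multiplicity[of "\<alpha> - \<beta>"] assms by auto
  have fin: "finite (carrier G)" and "\<exists>N. val2 (m + 4 * n) N \<and> int (order G) dvd N"
    using order_dvd[OF G(4) vm vn _ _ vd] assms by auto
  then obtain N where N: "val2 (m + 4 * n) N" "int (order G) dvd N" by blast
  have ndvd: "\<not> 2 ^ Suc (m + 4 * n) dvd order G"
  proof
    assume "2 ^ Suc (m + 4 * n) dvd order G"
    then have "int (2 ^ Suc (m + 4 * n)) dvd int (order G)" by (simp only: int_dvd_int_iff)
    then have "2 ^ Suc (m + 4 * n) dvd N" using N(2) by (simp add: dvd_trans)
    then show False unfolding val2_power_dvd[OF N(1)] by simp
  qed
  obtain u where u: "odd u" "\<alpha> - 1 = 2 ^ m * u" using vm by (auto simp: val2_def)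
  obtain v where v: "odd v" "\<beta> - 1 = 2 ^ n * v" using vn by (auto simp: val2_def)
  \<comment> \<open>With n = r + 2 the parameter p = 2^(n - 1) is visibly even, as the model
    requires; t = m - n - 1 is nonnegative because m > n.\<close>
  define r where "r = n - 2"
  have n: "n = Suc (Suc r)" using \<open>n > 1\<close> by (simp add: r_def)
  obtain t where m: "m = Suc (n + t)" using \<open>m > n\<close> less_imp_Suc_add by blast
  define p h :: int where "p = 2 ^ Suc r" and "h = 2 ^ t"
  interpret M: macdonald_model p h u v by unfold_locales (use u v in \<open>auto simp: p_def h_def\<close>)
  have ab: "\<alpha> = 1 + 4 * p * h * u" "\<beta> = 1 + 2 * p * v"
    using u(2) v(2) by (simp_all add: p_def h_def m n power_add algebra_simps)
  have pw: "8 * p^2 * h = 2 ^ (m + n)" "4 * p^2 = 2 ^ (2 * n)" "4 * p = 2 ^ (n + 1)" "2 * p = 2 ^ n"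
    by (simp_all add: p_def h_def m n power_add power_mult power2_eq_square algebra_simps)
  interpret H: macdonald M.H "M.ga 1" "M.gb 1" "M.gc 1" \<alpha> \<beta> unfolding ab by (rule M.macdonald_H)
  obtain \<phi> where \<phi>: "\<phi> \<in> hom G M.H" "\<phi> A = M.ga 1" "\<phi> B = M.gb 1"
    using presented_by_hom[OF pres H.is_group _ _ H.rels] by auto
  interpret \<phi>: group_hom G M.H \<phi> using G(1) H.is_group \<phi>(1)
      by (simp add: group_hom_def group_hom_axioms_def)
  have surj: "\<phi> ` carrier G = carrier M.H"
    using \<phi>.generate_img[of "{A, B}"] \<phi>(2,3) G(4) M.generate_H by simp
  have \<phi>C: "\<phi> (gcomm G A B) = M.gc 1" using \<phi>.hom_gcomm[of A B] \<phi>(2,3) H.gcomm_eq_C by simp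
  have "int (order M.H) = int (2 ^ (m + 4 * n))"
    unfolding order_def M.card_H unfolding pw by (simp add: algebra_simps flip: power_add)
  then have ordH: "order M.H = 2 ^ (m + 4 * n)" by (simp only: of_nat_eq_iff)
  have "int (H.ord (M.ga 1)) = int (2 ^ (m + n))" "int (H.ord (M.gb 1)) = int (2 ^ (2 * n))"
    "int (H.ord (M.gc 1)) = int (2 ^ (n + 1))"
    unfolding M.ord_H pw by simp_all
  then have ords: "H.ord (M.ga 1) = 2 ^ (m + n)" "H.ord (M.gb 1) = 2 ^ (2 * n)" "H.ord (M.gc 1)
      = 2 ^ (n + 1)"
    by (simp_all only: of_nat_eq_iff)
  have "card P = 2 ^ (m + 4 * n) \<and> nilpotency_class_is (G\<lparr>carrier := P\<rparr>) 3 \<and>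
       (\<forall>\<pi> \<in> hom G (G\<lparr>carrier := P\<rparr>). (\<forall>x \<in> P. \<pi> x = x) \<longrightarrow>
          ord (\<pi> A) = 2 ^ (m + n) \<and> ord (\<pi> B) = 2 ^ (2 * n) \<and> ord (\<pi> (gcomm G A B)) = 2 ^ (n + 1))"
    if P: "sylow2 G P" for P
  proof -
    interpret Q: two_quotient G M.H \<phi> "m + 4 * n" P
      by unfold_locales (use fin surj ordH ndvd P in auto)
    have "ord (\<pi> A) = 2 ^ (m + n) \<and> ord (\<pi> B) = 2 ^ (2 * n) \<and> ord (\<pi> (gcomm G A B)) = 2 ^ (n + 1)"
      if \<pi>: "\<pi> \<in> hom G (G\<lparr>carrier := P\<rparr>)" "\<forall>x \<in> P. \<pi> x = x" for \<pi>
    proof -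
      have "ord (\<pi> g) = H.ord (\<phi> g)" if "g \<in> carrier G" for g
        using Q.ord_P[of "\<pi> g"] Q.hom_retraction[OF \<pi> that] by simp
      then show ?thesis using G(2,3) \<phi>(2,3) \<phi>C ords gcomm_closed[OF G(2,3)] by simp
    qed
    then show ?thesis using Q.card_P Q.nilpotency_class_P[OF M.nilpotency_class_H] by blast
  qed
  then show ?thesis using fin by blast
qed

end
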